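(* Let $H$ be a connected bipartite graph. If $H$ is real-norming (respectively, weakly norming) for symmetric functions, then $H$ is real-norming (respectively, weakly norming) for asymmetric functions, i.e. on all of $\mathcal{F}_{\mathbb{R}}$.
   Context: $\mathcal{F}_{\mathbb{R}}$ is the real vector space of bounded measurable $f:[0,1]^2\to\mathbb{R}$, and $\mathcal{F}_{\mathbb{R}}^{\mathrm{sym}}$ the subspace of symmetric ones ($f(x,y)=f(y,x)$). A "norm" on such a space is a seminorm vanishing only on functions that are $0$ a.e. A bipartite graph $H$ is finite, nonempty, without isolated vertices, with fixed bipartition $A\cup B$, edges written $(u,v)$ with $u\in A$, $v\in B$. With variables $x_u$ ($u\in A$), $y_v$ ($v\in B$) in $[0,1]$ and Lebesgue measure, $t_H(f)=\int\prod_{(u,v)\in E(H)}f(x_u,y_v)$. $H$ is real-norming on a space $\mathcal{S}$ (either $\mathcal{F}_{\mathbb{R}}^{\mathrm{sym}}$ or $\mathcal{F}_{\mathbb{R}}$) if $f\mapsto|t_H(f)|^{1/|E(H)|}$ is a norm on $\mathcal{S}$, and weakly norming on $\mathcal{S}$ if $f\mapsto t_H(|f|)^{1/|E(H)|}$ is a norm on $\mathcal{S}$. "For symmetric functions" means on $\mathcal{F}_{\mathbb{R}}^{\mathrm{sym}}$. *)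

theory Defs
  imports "Graph_Theory.Digraph_Component" "HOL-Analysis.Analysis"
begin

text \<open>
  An edge is stored once, as the pair \<open>(u, v)\<close> with \<open>u \<in> A\<close> and \<open>v \<in> B\<close>, so
  \<open>card E\<close> is the number of edges of the undirected graph on \<open>A \<union> B\<close>.  One of
  \<open>A\<close>, \<open>B\<close> being empty is excluded by the last two assumptions.
\<close>

locale bipartite_graph =
  fixes A B :: "'v set" and E :: "('v \<times> 'v) set"
  assumes finite_parts: "finite A" "finite B"
    and disjoint_parts: "A \<inter> B = {}"
    and edges: "E \<subseteq> A \<times> B"
    and nonempty: "A \<union> B \<noteq> {}"
    and no_isolated: "\<And>w. w \<in> A \<union> B \<Longrightarrow> \<exists>e\<in>E. w = fst e \<or> w = snd e"

text \<open>
  \<^const>\<open>Digraph_Component.connected\<close> passes to the symmetric closure of the arcs,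
  so this is connectedness of the undirected graph.
\<close>

definition bipartite_connected :: "'v set \<Rightarrow> 'v set \<Rightarrow> ('v \<times> 'v) set \<Rightarrow> bool" where
  "bipartite_connected A B E \<longleftrightarrow>
     Digraph_Component.connected (with_proj \<lparr>pverts = A \<union> B, parcs = E\<rparr>)"

abbreviation unit_square :: "(real \<times> real) set" where
  "unit_square \<equiv> {0..1} \<times> {0..1}"

text \<open>
  Functions on the unit square are total functions on the plane; their values outside
  the square are unconstrained and play no role below.  Measurability is Lebesgue
  measurability.
\<close>

definition bounded_measurable :: "(real \<times> real \<Rightarrow> real) set" where
  "bounded_measurable =
     {f \<in> borel_measurable (lebesgue_on unit_square). bounded (f ` unit_square)}"

definition bounded_measurable_sym :: "(real \<times> real \<Rightarrow> real) set" where
  "bounded_measurable_sym =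
     {f \<in> bounded_measurable. \<forall>x\<in>{0..1}. \<forall>y\<in>{0..1}. f (x, y) = f (y, x)}"

text \<open>
  Lebesgue measure on the cube \<open>[0,1]\<^sup>V\<close>.  The completion matters: for a Lebesgue
  measurable \<open>f\<close> the map \<open>z \<mapsto> f (z u, z v)\<close> need not be measurable for the
  (incomplete) product measure.
\<close>

definition cube_measure :: "'v set \<Rightarrow> ('v \<Rightarrow> real) measure" where
  "cube_measure V = completion (PiM V (\<lambda>_. restrict_space lborel {0..1}))"

text \<open>
  As \<open>A\<close> and \<open>B\<close> are disjoint, a single family \<open>z\<close> indexed by \<open>A \<union> B\<close> comprises
  the variables \<open>x\<^sub>u = z u\<close> (\<open>u \<in> A\<close>) and \<open>y\<^sub>v = z v\<close> (\<open>v \<in> B\<close>).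
\<close>

definition hom_integral ::
    "'v set \<Rightarrow> 'v set \<Rightarrow> ('v \<times> 'v) set \<Rightarrow> (real \<times> real \<Rightarrow> real) \<Rightarrow> real" where
  "hom_integral A B E f =
     (\<integral>z. (\<Prod>(u, v)\<in>E. f (z u, z v)) \<partial>cube_measure (A \<union> B))"

definition seminorm_on ::
    "('a \<Rightarrow> real) set \<Rightarrow> (('a \<Rightarrow> real) \<Rightarrow> real) \<Rightarrow> bool" where
  "seminorm_on S N \<longleftrightarrow>
     (\<forall>f\<in>S. 0 \<le> N f) \<and>
     (\<forall>f\<in>S. \<forall>c. N (\<lambda>p. c * f p) = \<bar>c\<bar> * N f) \<and>
     (\<forall>f\<in>S. \<forall>g\<in>S. N (\<lambda>p. f p + g p) \<le> N f + N g)"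

definition norm_on ::
    "(real \<times> real \<Rightarrow> real) set \<Rightarrow> ((real \<times> real \<Rightarrow> real) \<Rightarrow> real) \<Rightarrow> bool" where
  "norm_on S N \<longleftrightarrow>
     seminorm_on S N \<and>
     (\<forall>f\<in>S. N f = 0 \<longrightarrow> (AE p in lebesgue_on unit_square. f p = 0))"

definition real_norming_on ::
    "(real \<times> real \<Rightarrow> real) set \<Rightarrow> 'v set \<Rightarrow> 'v set \<Rightarrow> ('v \<times> 'v) set \<Rightarrow> bool" where
  "real_norming_on S A B E \<longleftrightarrow>
     norm_on S (\<lambda>f. \<bar>hom_integral A B E f\<bar> powr (1 / real (card E)))"

definition weakly_norming_on ::
    "(real \<times> real \<Rightarrow> real) set \<Rightarrow> 'v set \<Rightarrow> 'v set \<Rightarrow> ('v \<times> 'v) set \<Rightarrow> bool" where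
  "weakly_norming_on S A B E \<longleftrightarrow>
     norm_on S (\<lambda>f. hom_integral A B E (\<lambda>p. \<bar>f p\<bar>) powr (1 / real (card E)))"

end

theory Submission
  imports Defs "HOL-Probability.Infinite_Product_Measure"
begin

text \<open>
  Let \<open>f\<^sup>T(x, y) = f(y, x)\<close>.  A measure preserving map from \<open>[0,1]\<close> to \<open>[0,1]\<^sup>2\<close> allows us to form
  tensor products of functions without leaving the unit square, and \<open>t\<^sub>H\<close> is multiplicative for
  them.  Placing \<open>f\<close> and \<open>f\<^sup>T\<close> in the two off-diagonal blocks of \<open>[0,1/2) \<union> [1/2,1]\<close> gives a symmetric
  function that depends linearly on \<open>f\<close>, and connectedness makes its integral a combination
  \<open>b t\<^sub>H(f) + b' t\<^sub>H(f\<^sup>T)\<close> with constants \<open>b > 0\<close> and \<open>b'\<close>.  If \<open>\<bar>t\<^sub>H(g)\<bar> > \<bar>t\<^sub>H(g\<^sup>T)\<bar>\<close> for some \<open>g\<close>,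
  replace \<open>f\<close> by \<open>f \<otimes> g \<otimes> \<dots> \<otimes> g\<close> and let the number of factors grow: in the limit only \<open>t\<^sub>H(f)\<close>
  survives, and the triangle inequality passes to the limit.  Otherwise \<open>t\<^sub>H(f) = t\<^sub>H(f\<^sup>T)\<close> for all
  \<open>f\<close>, and the two terms can be merged.  For definiteness, \<open>f(x\<^sub>1, y\<^sub>2) f(y\<^sub>1, x\<^sub>2)\<close> is a symmetric
  function of \<open>(x\<^sub>1, x\<^sub>2)\<close> and \<open>(y\<^sub>1, y\<^sub>2)\<close> whose integral is \<open>t\<^sub>H(f) t\<^sub>H(f\<^sup>T)\<close>; if \<open>t\<^sub>H(f) = 0\<close>, it
  vanishes almost everywhere, and so does \<open>f\<close>.
\<close>

section \<open>Splitting a uniform variable into two independent ones\<close>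

definition unit_uniform :: "real measure" where
  "unit_uniform = restrict_space lborel {0..1}"

lemma space_unit_uniform [simp]: "space unit_uniform = {0..1}"
  by (simp add: unit_uniform_def space_restrict_space)

lemma prob_space_unit_uniform: "prob_space unit_uniform"
  by (rule prob_spaceI) (simp add: unit_uniform_def emeasure_restrict_space space_restrict_space)

lemma measurable_unit_uniform [measurable (raw)]:
  "f \<in> borel \<rightarrow>\<^sub>M N \<Longrightarrow> f \<in> unit_uniform \<rightarrow>\<^sub>M N"
  unfolding unit_uniform_def by (intro measurable_restrict_space1) simp

lemma emeasure_unit_uniform:
  "X \<in> sets borel \<Longrightarrow> emeasure unit_uniform (X \<inter> {0..1}) = emeasure lborel (X \<inter> {0..1})"
  unfolding unit_uniform_def by (subst emeasure_restrict_space) auto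

section \<open>Interleaved binary digits and their joint law\<close>

definition binary_shift :: "real \<Rightarrow> real" where
  "binary_shift s = frac (2 * s)"

text \<open>Positions are counted from 0: for \<open>s\<close> in \<open>[0,1)\<close>, digit
  \<open>m\<close> is 1 iff the \<open>m\<close>-th iterate of the shift is at least
  \<open>1/2\<close>. The digits in positions 0, 2, 4, ... are read as a new binary
  expansion.\<close>

definition even_digits :: "real \<Rightarrow> real" where
  "even_digits s = (\<Sum>n. (1/2) ^ Suc n * of_bool (1/2 \<le> (binary_shift ^^ (2 * n)) s))"

definition odd_digits :: "real \<Rightarrow> real" where
  "odd_digits s = even_digits (binary_shift s)"

lemma measurable_binary_shift [measurable]: "binary_shift \<in> borel_measurable borel"
  unfolding binary_shift_def frac_def by measurable

lemma measurable_even_digits [measurable]: "even_digits \<in> borel_measurable borel"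
proof -
  have [measurable]: "(binary_shift ^^ n) \<in> borel_measurable borel" for n
    by (rule measurable_compose_n) measurable
  show ?thesis
    unfolding even_digits_def by measurable
qed

lemma measurable_odd_digits [measurable]: "odd_digits \<in> borel_measurable borel"
  unfolding odd_digits_def by measurable

lemma sums_half_powers: "(\<lambda>n. (1/2::real) ^ Suc n) sums 1"
  using power_half_series by simp

lemma summable_digits: "summable (\<lambda>n. (1/2::real) ^ Suc n * of_bool (P n))"
  by (rule summable_comparison_test'[OF sums_summable[OF sums_half_powers], where N = 0]) auto

lemma even_digits_range: "0 \<le> even_digits s" "even_digits s \<le> 1"
proof -
  show "0 \<le> even_digits s"
    unfolding even_digits_def by (intro suminf_nonneg summable_digits) auto
  have "even_digits s \<le> (\<Sum>n. (1/2::real) ^ Suc n)"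
    unfolding even_digits_def
    by (intro suminf_le summable_digits sums_summable[OF sums_half_powers]) auto
  then show "even_digits s \<le> 1"
    using sums_unique[OF sums_half_powers] by simp
qed

lemma odd_digits_range: "0 \<le> odd_digits s" "odd_digits s \<le> 1"
  unfolding odd_digits_def by (rule even_digits_range)+

text \<open>After the leading digit is split off, the positions 2, 4, ... of \<open>s\<close> are
  the positions 1, 3, ... of \<open>binary_shift s\<close>; the shift exchanges the two
  subsequences.\<close>

lemma even_digits_rec:
  "even_digits s = (of_bool (1/2 \<le> s) + odd_digits (binary_shift s)) / 2"
proof -
  have "even_digits s = of_bool (1/2 \<le> s) / 2 +
      (\<Sum>n. (1/2) ^ Suc (Suc n) * of_bool (1/2 \<le> (binary_shift ^^ (2 * Suc n)) s))"
    unfolding even_digits_def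
    using suminf_split_head[OF summable_digits[of "\<lambda>n. 1/2 \<le> (binary_shift ^^ (2 * n)) s"]]
    by (simp only: power_0 power_Suc mult_0_right funpow_0)
  also have "(\<Sum>n. (1/2::real) ^ Suc (Suc n) * of_bool (1/2 \<le> (binary_shift ^^ (2 * Suc n)) s)) =
      (\<Sum>n. (1/2) ^ Suc n * of_bool (1/2 \<le> (binary_shift ^^ (2 * n)) (binary_shift (binary_shift s))) / 2)"
    by (simp add: funpow_swap1 mult_ac)
  also have "\<dots> = odd_digits (binary_shift s) / 2"
    unfolding odd_digits_def even_digits_def by (intro suminf_divide summable_digits)
  finally show ?thesis by simp
qed

text \<open>The joint distribution function. The half-open interval is chosen because the shift maps
  each of its halves affinely onto the whole.\<close>

definition digits_cdf :: "real \<Rightarrow> real \<Rightarrow> real" where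
  "digits_cdf a b = measure lborel {s \<in> {0..<1}. even_digits s \<le> a \<and> odd_digits s \<le> b}"

text \<open>The distribution function of a uniform variable on \<open>[0,1]\<close>.\<close>

definition unit_clamp :: "real \<Rightarrow> real" where
  "unit_clamp a = max 0 (min 1 a)"

lemma measure_lborel_doubling:
  fixes X :: "real set" and d :: real
  assumes [measurable]: "X \<in> sets borel"
  shows "measure lborel {s. 2 * s - d \<in> X} = measure lborel X / 2"
proof -
  have "emeasure lborel {s. 2 * s - d \<in> X} = (\<integral>\<^sup>+s. indicator X (2 * s - d) \<partial>lborel)"
    by (subst nn_integral_indicator[symmetric])
      (auto intro!: nn_integral_cong simp: indicator_def simp del: nn_integral_indicator)
  moreover have "emeasure lborel X = 2 * (\<integral>\<^sup>+s. indicator X (2 * s - d) \<partial>lborel)"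
    using nn_integral_real_affine[of "indicator X" 2 "- d"] by (simp add: add.commute[of "- d"])
  ultimately have "emeasure lborel X = 2 * emeasure lborel {s. 2 * s - d \<in> X}"
    by simp
  then have "measure lborel X = 2 * measure lborel {s. 2 * s - d \<in> X}"
    unfolding measure_def by (simp add: enn2real_mult)
  then show ?thesis by simp
qed

text \<open>Condition on the leading digit. The bound \<open>a\<close> becomes the bound
  \<open>2 * a\<close> or \<open>2 * a - 1\<close> on the odd digits of the shifted point, and
  \<open>b\<close> becomes a bound on its even digits; hence the exchanged arguments. Each half of
  the interval has weight \<open>1/2\<close>.\<close>

lemma digits_cdf_rec:
  "digits_cdf a b = (digits_cdf b (2 * a) + digits_cdf b (2 * a - 1)) / 2"
proof -
  define X where "X a = {s \<in> {0..<1}. even_digits s \<le> b \<and> odd_digits s \<le> a}" for a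
  have X [measurable]: "X a \<in> sets borel" for a
    unfolding X_def by measurable
  have shift: "binary_shift s = 2 * s" if "0 \<le> s" "s < 1/2" for s
    unfolding binary_shift_def using that by (simp add: frac_eq)
  have shift': "binary_shift s = 2 * s - 1" if "1/2 \<le> s" "s < 1" for s
    unfolding binary_shift_def using that by (intro frac_unique_iff[THEN iffD2]) auto
  \<comment> \<open>The points with leading digit 0 and 1 respectively; writing
    \<open>2 * s - 0\<close> brings both under \<open>measure_lborel_doubling\<close>.\<close>
  let ?L = "{s. 2 * s - 0 \<in> X (2 * a)}" and ?R = "{s. 2 * s - 1 \<in> X (2 * a - 1)}"
  have split: "{s \<in> {0..<1}. even_digits s \<le> a \<and> odd_digits s \<le> b} = ?L \<union> ?R"
  proof (intro set_eqI)
    fix s :: real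
    consider "s < 0" | "0 \<le> s" "s < 1/2" | "1/2 \<le> s" "s < 1" | "1 \<le> s" by linarith
    then show "s \<in> {s \<in> {0..<1}. even_digits s \<le> a \<and> odd_digits s \<le> b} \<longleftrightarrow> s \<in> ?L \<union> ?R"
    proof cases
      case 2
      then show ?thesis
        using shift[OF 2] even_digits_rec[of s] by (auto simp: X_def odd_digits_def)
    next
      case 3
      then show ?thesis
        using shift'[OF 3] even_digits_rec[of s] by (auto simp: X_def odd_digits_def)
    qed (auto simp: X_def)
  qed
  have fin: "{s. 2 * s - d \<in> X a} \<in> fmeasurable lborel" if "d \<in> {0, 1}" for d a
    by (rule fmeasurableI2[OF fmeasurable_cbox[of 0 1]]) (use that in \<open>auto simp: X_def\<close>)
  have "digits_cdf a b = measure lborel ?L + measure lborel ?R"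
    unfolding digits_cdf_def split
    using fmeasurableD[OF fin] fmeasurableD2[OF fin]
    by (intro measure_Union) (metis insertCI infinity_ennreal_def, metis insertCI infinity_ennreal_def, blast, blast, auto simp: X_def)
  also have "\<dots> = measure lborel (X (2 * a)) / 2 + measure lborel (X (2 * a - 1)) / 2"
    by (simp only: measure_lborel_doubling X)
  finally show ?thesis
    by (simp add: digits_cdf_def X_def)
qed

text \<open>The one-variable counterpart of \<open>digits_cdf_rec\<close>; it makes the product of
  two clamps obey that recursion.\<close>

lemma unit_clamp_rec: "unit_clamp a = (unit_clamp (2 * a) + unit_clamp (2 * a - 1)) / 2"
  by (auto simp: unit_clamp_def max_def min_def)

text \<open>
  After two steps of the digit recursion the defect of the distribution function is the average
  of four defects, one of which belongs to a trivial pair of arguments.  Hence the defect is zero.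
\<close>

lemma digits_cdf_eq: "digits_cdf a b = unit_clamp a * unit_clamp b"
proof -
  define D where "D a b = digits_cdf a b - unit_clamp a * unit_clamp b" for a b
  have step: "D a b = (D b (2 * a) + D b (2 * a - 1)) / 2" for a b
    unfolding D_def digits_cdf_rec[of a b] by (subst unit_clamp_rec[of a]) (simp add: field_simps)
  \<comment> \<open>Two steps exchange the arguments twice and so restore their order.\<close>
  have D4: "D a b = (D (2 * a) (2 * b) + D (2 * a) (2 * b - 1)
      + D (2 * a - 1) (2 * b) + D (2 * a - 1) (2 * b - 1)) / 4" for a b
    using step[of a b] step[of b "2 * a"] step[of b "2 * a - 1"] by argo
  have D0: "D a b = 0" if "a < 0 \<or> b < 0" for a b
  proof -
    have "{s \<in> {0..<1}. even_digits s \<le> a \<and> odd_digits s \<le> b} = {}"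
      using that even_digits_range(1) odd_digits_range(1) by (auto simp: not_le) (meson not_le order_trans)+
    then have "digits_cdf a b = 0"
      unfolding digits_cdf_def by (simp only: measure_empty)
    then show ?thesis
      using that by (auto simp: D_def unit_clamp_def)
  qed
  have D1: "D a b = 0" if "1 \<le> a" "1 \<le> b" for a b
  proof -
    have "{s \<in> {0..<1}. even_digits s \<le> a \<and> odd_digits s \<le> b} = {0..<1}"
      using that even_digits_range(2) odd_digits_range(2) by (auto intro: order_trans)
    then have "digits_cdf a b = 1"
      unfolding digits_cdf_def by simp
    then show ?thesis
      using that by (auto simp: D_def unit_clamp_def)
  qed
  have bound: "\<bar>D a b\<bar> \<le> (3/4) ^ n" for n a b
  proof (induction n arbitrary: a b)
    case 0
    have "digits_cdf a b \<le> measure lborel {0..<1::real}"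
      unfolding digits_cdf_def by (rule measure_mono_fmeasurable) (auto intro: fmeasurableI)
    moreover have "0 \<le> digits_cdf a b"
      by (simp add: digits_cdf_def)
    moreover have "0 \<le> unit_clamp a * unit_clamp b" "unit_clamp a * unit_clamp b \<le> 1"
      by (auto simp: unit_clamp_def intro!: mult_le_one)
    ultimately show ?case
      by (simp add: D_def)
  next
    case (Suc n)
    \<comment> \<open>Either \<open>2 * a - 1\<close> or \<open>2 * b - 1\<close> is negative, or
      both \<open>2 * a\<close> and \<open>2 * b\<close> are at least 1. One of the four summands
      drops out, which gives the factor \<open>3/4\<close>.\<close>
    have "D (2 * a) (2 * b) = 0 \<or> D (2 * a) (2 * b - 1) = 0 \<or> D (2 * a - 1) (2 * b) = 0 \<or>
        D (2 * a - 1) (2 * b - 1) = 0"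
      using D0[of "2 * a - 1" "2 * b - 1"] D1[of "2 * a" "2 * b"] by linarith
    then show ?case
      using D4[of a b] Suc[of "2 * a" "2 * b"] Suc[of "2 * a" "2 * b - 1"]
        Suc[of "2 * a - 1" "2 * b"] Suc[of "2 * a - 1" "2 * b - 1"]
      by auto
  qed
  have "(\<lambda>n. (3/4::real) ^ n) \<longlonglongrightarrow> 0"
    by (rule LIMSEQ_power_zero) simp
  then have "\<bar>D a b\<bar> \<le> 0"
    by (rule LIMSEQ_le_const) (use bound in auto)
  then show ?thesis
    by (simp add: D_def)
qed

lemma digits_atMost:
  "measure unit_uniform {s \<in> {0..1}. even_digits s \<le> a \<and> odd_digits s \<le> b} =
    unit_clamp a * unit_clamp b"
proof -
  have "measure unit_uniform {s \<in> {0..1}. even_digits s \<le> a \<and> odd_digits s \<le> b} =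
      measure lborel {s \<in> {0..1}. even_digits s \<le> a \<and> odd_digits s \<le> b}"
    unfolding unit_uniform_def by (rule measure_restrict_space) auto
  also have "\<dots> = digits_cdf a b"
    unfolding digits_cdf_def
    by (rule measure_eq_AE) (use AE_lborel_singleton[of "1::real"] in \<open>auto elim!: eventually_mono\<close>)
  finally show ?thesis
    by (simp add: digits_cdf_eq)
qed

lemma unit_clamp_nonneg: "0 \<le> unit_clamp a"
  by (simp add: unit_clamp_def)

lemma unit_uniform_atMost: "measure unit_uniform ({..a} \<inter> {0..1}) = unit_clamp a"
proof -
  have "{..a} \<inter> {0..1} = (if 0 \<le> a then {0..min 1 a} else {})" by auto
  then have "emeasure lborel ({..a} \<inter> {0..1}) = ennreal (unit_clamp a)"
    by (auto simp: unit_clamp_def min_def max_def)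
  then show ?thesis
    using unit_clamp_nonneg[of a] by (simp only: measure_def emeasure_unit_uniform atMost_borel enn2real_ennreal)
qed

text \<open>Quadrants are stable under intersection and generate the Borel sets of the plane, so it
  suffices that the joint law and the product law agree on them, which is
  \<open>digits_atMost\<close>.\<close>

lemma digits_independent:
  assumes [measurable]: "X \<in> sets borel" "Y \<in> sets borel"
  shows "emeasure unit_uniform {s \<in> {0..1}. even_digits s \<in> X \<and> odd_digits s \<in> Y} =
    emeasure unit_uniform (X \<inter> {0..1}) * emeasure unit_uniform (Y \<inter> {0..1})"
proof -
  interpret U: prob_space unit_uniform by (rule prob_space_unit_uniform)
  interpret UU: pair_prob_space unit_uniform unit_uniform ..
  let ?M = "distr unit_uniform borel (\<lambda>s. (even_digits s, odd_digits s))"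
  \<comment> \<open>The identity map carries the product measure to the Borel sets of the plane,
    where both laws can be compared.\<close>
  let ?N = "distr (unit_uniform \<Otimes>\<^sub>M unit_uniform) borel (\<lambda>p. (fst p, snd p))"
  have fst [measurable]: "fst \<in> borel_measurable (unit_uniform \<Otimes>\<^sub>M unit_uniform)"
    and snd [measurable]: "snd \<in> borel_measurable (unit_uniform \<Otimes>\<^sub>M unit_uniform)"
    by (auto intro!: measurable_compose[OF measurable_fst] measurable_compose[OF measurable_snd]
      measurable_unit_uniform)
  have N: "emeasure ?N (X \<times> Y) =
      emeasure unit_uniform (X \<inter> {0..1}) * emeasure unit_uniform (Y \<inter> {0..1})"
    if [measurable]: "X \<in> sets borel" "Y \<in> sets borel" for X Y
  proof -
    have XY: "X \<times> Y \<in> sets borel"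
      unfolding borel_prod[symmetric] by simp
    have sets: "Z \<inter> {0..1} \<in> sets unit_uniform" if "Z \<in> sets borel" for Z
      using that by (auto simp: unit_uniform_def sets_restrict_space_iff)
    have "(\<lambda>p. (fst p, snd p)) -` (X \<times> Y) \<inter> space (unit_uniform \<Otimes>\<^sub>M unit_uniform) =
        (X \<inter> {0..1}) \<times> (Y \<inter> {0..1})"
      by (auto simp: space_pair_measure)
    then show ?thesis
      using sets by (subst emeasure_distr[OF borel_measurable_Pair[OF fst snd] XY])
        (simp add: U.emeasure_pair_measure_Times)
  qed
  have M: "emeasure ?M (X \<times> Y) =
      emeasure unit_uniform {s \<in> {0..1}. even_digits s \<in> X \<and> odd_digits s \<in> Y}"
    if [measurable]: "X \<in> sets borel" "Y \<in> sets borel" for X Y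
  proof -
    have XY: "X \<times> Y \<in> sets borel"
      unfolding borel_prod[symmetric] by simp
    show ?thesis
      by (subst emeasure_distr) (auto simp: XY intro!: arg_cong[where f = "emeasure unit_uniform"])
  qed
  have quadrant: "{..p} = {..fst p} \<times> {..snd p}" for p :: "real \<times> real"
    by (auto simp: less_eq_prod_def)
  have "?M = ?N"
  proof (rule measure_eqI_generator_eq[where E = "range atMost" and \<Omega> = UNIV and
        A = "\<lambda>n. {..(real n, real n)}"])
    show "Int_stable (range (atMost :: real \<times> real \<Rightarrow> _))"
    proof -
      have "{..a} \<inter> {..b} = {..inf a b}" for a b :: "real \<times> real" by auto
      then show ?thesis by (auto simp: Int_stable_def)
    qed
    show "sets ?M = sigma_sets UNIV (range atMost)" "sets ?N = sigma_sets UNIV (range atMost)"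
      by (simp_all add: borel_eq_atMost)
    show "(\<Union>n. {..(real n, real n)}) = UNIV"
    proof (rule UNIV_eq_I[symmetric])
      fix p :: "real \<times> real"
      obtain n :: nat where "max (fst p) (snd p) \<le> real n"
        using real_arch_simple by blast
      then show "p \<in> (\<Union>n. {..(real n, real n)})"
        by (auto simp: quadrant mem_Times_iff)
    qed
    fix Z :: "(real \<times> real) set"
    assume "Z \<in> range atMost"
    then obtain p where Z: "Z = {..fst p} \<times> {..snd p}"
      by (auto simp: quadrant)
    show "emeasure ?M Z = emeasure ?N Z"
      unfolding Z
      by (subst M, simp, simp, subst N, simp, simp)
        (simp only: atMost_iff U.emeasure_eq_measure digits_atMost
          unit_uniform_atMost ennreal_mult unit_clamp_nonneg)
  next
    interpret M: prob_space ?M by (rule U.prob_space_distr) measurable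
    show "emeasure ?M {..(real n, real n)} \<noteq> \<infinity>" for n
      by simp
  qed auto
  then show ?thesis
    using M[of X Y] N[of X Y] by simp
qed

section \<open>The unit cube\<close>

text \<open>The product measure before completion; \<open>hom_integral_eq_pattern_integral\<close>
  leads from \<open>cube_measure\<close> to it.\<close>

definition unit_cube :: "'v set \<Rightarrow> ('v \<Rightarrow> real) measure" where
  "unit_cube V = PiM V (\<lambda>_. unit_uniform)"

lemma prob_space_unit_cube: "prob_space (unit_cube V)"
  unfolding unit_cube_def by (intro prob_space_PiM prob_space_unit_uniform)

lemma space_unit_cube: "space (unit_cube V) = V \<rightarrow>\<^sub>E {0..1}"
  by (simp add: unit_cube_def space_PiM)

lemma measurable_cube_coordinate:
  "v \<in> V \<Longrightarrow> (\<lambda>z. z v) \<in> borel_measurable (unit_cube V)"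
  unfolding unit_cube_def
  by (rule measurable_compose[OF measurable_component_singleton[of v V "\<lambda>_. unit_uniform"]])
    (auto intro: measurable_unit_uniform)

lemma measurable_into_unit_cube:
  assumes "\<And>v. v \<in> V \<Longrightarrow> g v \<in> borel_measurable M"
    and "\<And>v x. v \<in> V \<Longrightarrow> x \<in> space M \<Longrightarrow> g v x \<in> {0..1}"
  shows "(\<lambda>x. \<lambda>v\<in>V. g v x) \<in> M \<rightarrow>\<^sub>M unit_cube V"
  unfolding unit_cube_def unit_uniform_def
  by (intro measurable_restrict measurable_restrict_space2) (use assms in auto)

lemma measurable_reindex_unit_cube:
  "\<iota> \<in> V \<rightarrow> W \<Longrightarrow> (\<lambda>w. \<lambda>v\<in>V. w (\<iota> v)) \<in> unit_cube W \<rightarrow>\<^sub>M unit_cube V"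
  by (rule measurable_into_unit_cube) (auto simp: space_unit_cube intro!: measurable_cube_coordinate)

text \<open>The marginal of independent uniform coordinates along an injection is again a
  cube.\<close>

lemma reindex_unit_cube:
  assumes "inj_on \<iota> V" "\<iota> \<in> V \<rightarrow> W" "h \<in> borel_measurable (unit_cube V)"
  shows "(\<integral>w. h (\<lambda>v\<in>V. w (\<iota> v)) \<partial>unit_cube W) = (\<integral>z. h z \<partial>unit_cube V :: real)"
proof -
  have "unit_cube V = distr (unit_cube W) (unit_cube V) (\<lambda>w. \<lambda>v\<in>V. w (\<iota> v))"
    unfolding unit_cube_def
    using distr_PiM_reindex[OF prob_space_unit_uniform assms(1,2)] by (rule sym)
  then show ?thesis
    using integral_distr[OF measurable_reindex_unit_cube[OF assms(2)] assms(3)] by simp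
qed

section \<open>Splitting every coordinate of the cube\<close>

definition digit_part :: "bool \<Rightarrow> real \<Rightarrow> real" where
  "digit_part c = (if c then even_digits else odd_digits)"

lemma measurable_digit_part [measurable]: "digit_part c \<in> borel_measurable borel"
  by (simp add: digit_part_def)

lemma digit_part_range: "digit_part c s \<in> {0..1}"
  using even_digits_range odd_digits_range by (simp add: digit_part_def)

lemma digit_parts_independent:
  assumes "X \<in> sets unit_uniform" "Y \<in> sets unit_uniform"
  shows "emeasure unit_uniform {s \<in> {0..1}. digit_part c s \<in> X \<and> digit_part (\<not> c) s \<in> Y} =
    emeasure unit_uniform X * emeasure unit_uniform Y"
proof -
  have "X \<in> sets borel" "Y \<in> sets borel" "X \<inter> {0..1} = X" "Y \<inter> {0..1} = Y"
    using assms by (auto simp: unit_uniform_def sets_restrict_space_iff)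
  then show ?thesis
    using digits_independent[of X Y] digits_independent[of Y X]
    by (simp add: digit_part_def conj_commute mult.commute)
qed

text \<open>\<open>\<beta> v\<close> selects the digits of coordinate \<open>v\<close> that go to
  the left copy of \<open>V\<close>; for \<open>twist_fun\<close> this choice depends on the side of
  the bipartition. The preimage of a box is a box, and \<open>digit_parts_independent\<close>
  measures its sides.\<close>

lemma unit_cube_digit_parts:
  fixes \<beta> :: "'v \<Rightarrow> bool"
  assumes "finite V"
  defines "\<Theta> \<equiv> \<lambda>z. \<lambda>i\<in>V <+> V.
      case i of Inl v \<Rightarrow> digit_part (\<beta> v) (z v) | Inr v \<Rightarrow> digit_part (\<not> \<beta> v) (z v)"
  shows "\<Theta> \<in> unit_cube V \<rightarrow>\<^sub>M unit_cube (V <+> V)"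
    and "distr (unit_cube V) (unit_cube (V <+> V)) \<Theta> = unit_cube (V <+> V)"
proof -
  interpret U: prob_space unit_uniform by (rule prob_space_unit_uniform)
  interpret product_sigma_finite "\<lambda>_. unit_uniform" ..
  show meas: "\<Theta> \<in> unit_cube V \<rightarrow>\<^sub>M unit_cube (V <+> V)"
    unfolding \<Theta>_def
    by (rule measurable_into_unit_cube)
      (auto intro!: measurable_compose[OF measurable_cube_coordinate measurable_digit_part]
        simp: digit_part_range[simplified])
  show "distr (unit_cube V) (unit_cube (V <+> V)) \<Theta> = unit_cube (V <+> V)"
    unfolding unit_cube_def[of "V <+> V"]
  proof (rule PiM_eqI)
    fix A :: "'v + 'v \<Rightarrow> real set"
    assume A: "\<And>i. i \<in> V <+> V \<Longrightarrow> A i \<in> sets unit_uniform"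
    define X where "X v = {s \<in> {0..1}. digit_part (\<beta> v) s \<in> A (Inl v) \<and>
      digit_part (\<not> \<beta> v) s \<in> A (Inr v)}" for v
    have X: "X v \<in> sets unit_uniform" if "v \<in> V" for v
    proof -
      have [measurable]: "A (Inl v) \<in> sets borel" "A (Inr v) \<in> sets borel"
        using A[of "Inl v"] A[of "Inr v"] that by (auto simp: unit_uniform_def sets_restrict_space_iff)
      have "{s \<in> {0..1}. digit_part (\<beta> v) s \<in> A (Inl v) \<and> digit_part (\<not> \<beta> v) s \<in> A (Inr v)} \<in> sets borel"
        by measurable
      then show ?thesis
        by (auto simp: unit_uniform_def sets_restrict_space_iff X_def)
    qed
    have "\<Theta> -` (Pi\<^sub>E (V <+> V) A) \<inter> space (unit_cube V) = Pi\<^sub>E V X"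
      by (auto simp: \<Theta>_def X_def space_unit_cube PiE_iff Ball_def extensional_def split: sum.splits)
        (force)+
    moreover have "Pi\<^sub>E (V <+> V) A \<in> sets (unit_cube (V <+> V))"
      unfolding unit_cube_def by (rule sets_PiM_I_finite) (use A assms(1) in auto)
    ultimately have "emeasure (distr (unit_cube V) (unit_cube (V <+> V)) \<Theta>) (Pi\<^sub>E (V <+> V) A) =
        emeasure (unit_cube V) (Pi\<^sub>E V X)"
      using meas by (simp add: emeasure_distr)
    also have "\<dots> = (\<Prod>v\<in>V. emeasure unit_uniform (X v))"
      unfolding unit_cube_def by (rule emeasure_PiM) (use X assms(1) in auto)
    also have "\<dots> = (\<Prod>v\<in>V. emeasure unit_uniform (A (Inl v)) * emeasure unit_uniform (A (Inr v)))"
      unfolding X_def by (intro prod.cong refl digit_parts_independent) (use A in auto)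
    also have "\<dots> = (\<Prod>i\<in>V <+> V. emeasure unit_uniform (A i))"
      using assms(1) by (simp add: prod.distrib prod.Plus comp_def)
    finally show "emeasure (distr (unit_cube V) (Pi\<^sub>M (V <+> V) (\<lambda>_. unit_uniform)) \<Theta>)
        (Pi\<^sub>E (V <+> V) A) = (\<Prod>i\<in>V <+> V. emeasure unit_uniform (A i))"
      by (simp add: unit_cube_def)
  qed (use assms(1) in auto)
qed

text \<open>\<open>h\<close> and \<open>k\<close> see complementary digits, which are independent
  uniform points by \<open>unit_cube_digit_parts\<close>. The integral therefore factors by Fubini
  on \<open>V <+> V\<close>; the bounds supply integrability.\<close>

lemma integral_digit_parts:
  fixes \<beta> :: "'v \<Rightarrow> bool" and h k :: "('v \<Rightarrow> real) \<Rightarrow> real"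
  assumes fin: "finite V"
    and h: "h \<in> borel_measurable (unit_cube V)" "\<And>z. \<bar>h z\<bar> \<le> C"
    and k: "k \<in> borel_measurable (unit_cube V)" "\<And>z. \<bar>k z\<bar> \<le> D"
  shows "(\<integral>z. h (\<lambda>v\<in>V. digit_part (\<beta> v) (z v)) * k (\<lambda>v\<in>V. digit_part (\<not> \<beta> v) (z v)) \<partial>unit_cube V) =
    (\<integral>z. h z \<partial>unit_cube V) * (\<integral>z. k z \<partial>unit_cube V)"
proof -
  interpret U: prob_space unit_uniform by (rule prob_space_unit_uniform)
  interpret product_sigma_finite "\<lambda>_::'v + 'v. unit_uniform" ..
  interpret VV: prob_space "unit_cube (V <+> V)" by (rule prob_space_unit_cube)
  define g where "g w = h (\<lambda>v\<in>V. w (Inl v)) * k (\<lambda>v\<in>V. w (Inr v))" for w :: "'v + 'v \<Rightarrow> real"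
  have g: "g \<in> borel_measurable (unit_cube (V <+> V))"
    unfolding g_def
    by (intro borel_measurable_times 
        measurable_compose[OF measurable_reindex_unit_cube h(1)]
        measurable_compose[OF measurable_reindex_unit_cube k(1)])
      auto
  have merge_l: "(\<lambda>v\<in>V. merge (Inl ` V) (Inr ` V) (x, y) (Inl v)) = (\<lambda>v\<in>V. x (Inl v))"
    and merge_r: "(\<lambda>v\<in>V. merge (Inl ` V) (Inr ` V) (x, y) (Inr v)) = (\<lambda>v\<in>V. y (Inr v))"
    for x y :: "'v + 'v \<Rightarrow> real"
    by (auto simp: fun_eq_iff merge_def)
  have "\<bar>g w\<bar> \<le> C * D" for w
    unfolding g_def abs_mult using h(2) k(2) by (intro mult_mono) (auto intro: order_trans[OF abs_ge_zero])
  then have int: "integrable (unit_cube (V <+> V)) g"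
    using g by (intro VV.integrable_const_bound[where B = "C * D"]) auto
  have "(\<integral>z. h (\<lambda>v\<in>V. digit_part (\<beta> v) (z v)) * k (\<lambda>v\<in>V. digit_part (\<not> \<beta> v) (z v)) \<partial>unit_cube V) =
      (\<integral>z. g (\<lambda>i\<in>V <+> V. case i of Inl v \<Rightarrow> digit_part (\<beta> v) (z v)
        | Inr v \<Rightarrow> digit_part (\<not> \<beta> v) (z v)) \<partial>unit_cube V)"
    unfolding g_def by (intro Bochner_Integration.integral_cong refl arg_cong2[where f = "(*)"]
        arg_cong[where f = h] arg_cong[where f = k]) (auto simp: fun_eq_iff)
  also have "\<dots> = (\<integral>w. g w \<partial>unit_cube (V <+> V))"
    using integral_distr[OF unit_cube_digit_parts(1)[OF fin, of \<beta>] g]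
    by (simp add: unit_cube_digit_parts(2)[OF fin])
  also have "\<dots> = (\<integral>x. \<integral>y. g (merge (Inl ` V) (Inr ` V) (x, y)) \<partial>unit_cube (Inr ` V :: ('v + 'v) set) \<partial>unit_cube (Inl ` V :: ('v + 'v) set))"
    using int fin unfolding unit_cube_def Plus_def by (intro product_integral_fold) auto
  also have "\<dots> = (\<integral>x. \<integral>y. h (\<lambda>v\<in>V. x (Inl v)) * k (\<lambda>v\<in>V. y (Inr v))
      \<partial>unit_cube (Inr ` V :: ('v + 'v) set) \<partial>unit_cube (Inl ` V :: ('v + 'v) set))"
    by (simp only: g_def merge_l merge_r)
  also have "\<dots> = (\<integral>x. h (\<lambda>v\<in>V. x (Inl v)) \<partial>unit_cube (Inl ` V :: ('v + 'v) set)) *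
      (\<integral>y. k (\<lambda>v\<in>V. y (Inr v)) \<partial>unit_cube (Inr ` V :: ('v + 'v) set))"
    by simp
  also have "\<dots> = (\<integral>z. h z \<partial>unit_cube V) * (\<integral>z. k z \<partial>unit_cube V)"
    by (subst (1 2) reindex_unit_cube) (auto simp: h k inj_on_def)
  finally show ?thesis .
qed

section \<open>Integrals of edge products\<close>

text \<open>Borel measurability survives composition with the digit maps, whereas Lebesgue
  measurability need not; all constructions therefore take place in this class.\<close>

definition bounded_borel :: "(real \<times> real \<Rightarrow> real) set" where
  "bounded_borel = {f \<in> borel_measurable borel. \<exists>C. \<forall>p. \<bar>f p\<bar> \<le> C}"

lemma bounded_borelI:
  "f \<in> borel_measurable borel \<Longrightarrow> (\<And>p. \<bar>f p\<bar> \<le> C) \<Longrightarrow> f \<in> bounded_borel"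
  by (auto simp: bounded_borel_def)

lemma bounded_borelE:
  assumes "f \<in> bounded_borel"
  obtains C where "f \<in> borel_measurable borel" "\<forall>p. \<bar>f p\<bar> \<le> C" "0 \<le> C"
proof -
  obtain C where "f \<in> borel_measurable borel" "\<forall>p. \<bar>f p\<bar> \<le> C"
    using assms by (auto simp: bounded_borel_def)
  moreover from this(2) have "0 \<le> C"
    using abs_ge_zero order_trans by blast
  ultimately show ?thesis by (rule that)
qed

lemma bounded_borel_measurable: "f \<in> bounded_borel \<Longrightarrow> f \<in> borel_measurable borel"
  by (simp add: bounded_borel_def)

lemma bounded_borel_const: "(\<lambda>p. c) \<in> bounded_borel"
  by (rule bounded_borelI[where C = "\<bar>c\<bar>"]) auto

lemma bounded_borel_abs: "f \<in> bounded_borel \<Longrightarrow> (\<lambda>p. \<bar>f p\<bar>) \<in> bounded_borel"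
  by (auto simp: bounded_borel_def)

lemma bounded_borel_add:
  assumes "f \<in> bounded_borel" "g \<in> bounded_borel"
  shows "(\<lambda>p. f p + g p) \<in> bounded_borel"
proof -
  obtain C where f: "f \<in> borel_measurable borel" "\<forall>p. \<bar>f p\<bar> \<le> C" "0 \<le> C"
    using assms(1) by (rule bounded_borelE)
  obtain D where g: "g \<in> borel_measurable borel" "\<forall>p. \<bar>g p\<bar> \<le> D" "0 \<le> D"
    using assms(2) by (rule bounded_borelE)
  show ?thesis
  proof (rule bounded_borelI)
    show "(\<lambda>p. f p + g p) \<in> borel_measurable borel"
      using f g by (intro borel_measurable_add)
    show "\<bar>f p + g p\<bar> \<le> C + D" for p
      using f(2)[rule_format, of p] g(2)[rule_format, of p] by linarith
  qed
qed

lemma bounded_borel_mult: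
  assumes "f \<in> bounded_borel" "g \<in> bounded_borel"
  shows "(\<lambda>p. f p * g p) \<in> bounded_borel"
proof -
  obtain C where f: "f \<in> borel_measurable borel" "\<forall>p. \<bar>f p\<bar> \<le> C" "0 \<le> C"
    using assms(1) by (rule bounded_borelE)
  obtain D where g: "g \<in> borel_measurable borel" "\<forall>p. \<bar>g p\<bar> \<le> D" "0 \<le> D"
    using assms(2) by (rule bounded_borelE)
  show ?thesis
  proof (rule bounded_borelI)
    show "(\<lambda>p. f p * g p) \<in> borel_measurable borel"
      using f g by (intro borel_measurable_times)
    show "\<bar>f p * g p\<bar> \<le> C * D" for p
      unfolding abs_mult using f(2)[rule_format, of p] g(2)[rule_format, of p] f(3) by (intro mult_mono) auto
  qed
qed

lemma bounded_borel_compose: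
  assumes "f \<in> bounded_borel" and [measurable]: "r \<in> borel_measurable borel" "s \<in> borel_measurable borel"
  shows "(\<lambda>p. f (r p, s p)) \<in> bounded_borel"
proof -
  obtain C where [measurable]: "f \<in> borel_measurable borel" and C: "\<forall>p. \<bar>f p\<bar> \<le> C" "0 \<le> C"
    using assms(1) by (rule bounded_borelE)
  show ?thesis
    by (rule bounded_borelI[where C = C]) (measurable, rule C(1)[rule_format])
qed

section \<open>Transposes, tensor products and the twist\<close>

definition transpose_fun :: "(real \<times> real \<Rightarrow> real) \<Rightarrow> real \<times> real \<Rightarrow> real" where
  "transpose_fun f p = f (snd p, fst p)"

text \<open>A number \<open>x\<close> stands for the pair
  \<open>(digit_part True x, digit_part False x)\<close>; \<open>f\<close> sees the first components
  and \<open>g\<close> the second ones.\<close>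

definition tensor_fun :: "(real \<times> real \<Rightarrow> real) \<Rightarrow> (real \<times> real \<Rightarrow> real) \<Rightarrow> real \<times> real \<Rightarrow> real" where
  "tensor_fun f g p = f (digit_part True (fst p), digit_part True (snd p)) *
    g (digit_part False (fst p), digit_part False (snd p))"

definition twist_fun :: "(real \<times> real \<Rightarrow> real) \<Rightarrow> real \<times> real \<Rightarrow> real" where
  "twist_fun f p = f (digit_part True (fst p), digit_part False (snd p)) *
    f (digit_part True (snd p), digit_part False (fst p))"

lemma borel_measurable_fst: "(fst :: real \<times> real \<Rightarrow> real) \<in> borel_measurable borel"
  and borel_measurable_snd: "(snd :: real \<times> real \<Rightarrow> real) \<in> borel_measurable borel"
  by (intro borel_measurable_continuous_onI continuous_intros)+

lemma bounded_borel_transpose: "f \<in> bounded_borel \<Longrightarrow> transpose_fun f \<in> bounded_borel"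
  unfolding transpose_fun_def[abs_def] by (intro bounded_borel_compose borel_measurable_fst borel_measurable_snd)

lemma measurable_digit_part_prod [measurable]:
  "(\<lambda>p::real \<times> real. digit_part c (fst p)) \<in> borel_measurable borel"
  "(\<lambda>p::real \<times> real. digit_part c (snd p)) \<in> borel_measurable borel"
  by (intro measurable_compose[OF borel_measurable_fst measurable_digit_part]
      measurable_compose[OF borel_measurable_snd measurable_digit_part])+

lemma bounded_borel_tensor:
  "f \<in> bounded_borel \<Longrightarrow> g \<in> bounded_borel \<Longrightarrow> tensor_fun f g \<in> bounded_borel"
  unfolding tensor_fun_def[abs_def]
  by (intro bounded_borel_mult bounded_borel_compose measurable_digit_part_prod)

lemma bounded_borel_twist: "f \<in> bounded_borel \<Longrightarrow> twist_fun f \<in> bounded_borel"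
  unfolding twist_fun_def[abs_def]
  by (intro bounded_borel_mult bounded_borel_compose measurable_digit_part_prod)

text \<open>\<open>E\<close> may be any set of ordered pairs, so that reversed edges are covered
  too; \<open>definite\<close> uses one.\<close>

definition pattern_product ::
    "('v \<times> 'v) set \<Rightarrow> (real \<times> real \<Rightarrow> real) \<Rightarrow> ('v \<Rightarrow> real) \<Rightarrow> real" where
  "pattern_product E f z = (\<Prod>e\<in>E. f (z (fst e), z (snd e)))"

definition pattern_integral ::
    "'v set \<Rightarrow> ('v \<times> 'v) set \<Rightarrow> (real \<times> real \<Rightarrow> real) \<Rightarrow> real" where
  "pattern_integral V E f = (\<integral>z. pattern_product E f z \<partial>unit_cube V)"

lemma measurable_edge:
  assumes "u \<in> V" "v \<in> V"
  shows "(\<lambda>z. (z u, z v)) \<in> borel_measurable (unit_cube V)"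
  using assms by (intro borel_measurable_Pair measurable_cube_coordinate)

lemma measurable_pattern_product:
  assumes "E \<subseteq> V \<times> V" "f \<in> borel_measurable borel"
  shows "pattern_product E f \<in> borel_measurable (unit_cube V)"
  unfolding pattern_product_def[abs_def]
  by (intro borel_measurable_prod measurable_compose[OF measurable_edge assms(2)]) (use assms(1) in auto)

lemma pattern_product_le:
  assumes "\<And>p. \<bar>f p\<bar> \<le> C"
  shows "\<bar>pattern_product E f z\<bar> \<le> C ^ card E"
proof -
  have "\<bar>pattern_product E f z\<bar> \<le> (\<Prod>e\<in>E. C)"
    unfolding pattern_product_def abs_prod by (intro prod_mono conjI abs_ge_zero assms)
  then show ?thesis by simp
qed

lemma integrable_pattern_product:
  assumes "E \<subseteq> V \<times> V" "f \<in> bounded_borel"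
  shows "integrable (unit_cube V) (pattern_product E f)"
proof -
  interpret prob_space "unit_cube V" by (rule prob_space_unit_cube)
  obtain C where f: "f \<in> borel_measurable borel" "\<forall>p. \<bar>f p\<bar> \<le> C" "0 \<le> C"
    using assms(2) by (rule bounded_borelE)
  have "\<bar>pattern_product E f z\<bar> \<le> C ^ card E" for z
    using f(2) by (intro pattern_product_le) blast
  then show ?thesis
    by (intro integrable_const_bound[where B = "C ^ card E"] AE_I2 measurable_pattern_product assms f)
      simp
qed

lemma pattern_product_restrict:
  assumes "E \<subseteq> V \<times> V"
  shows "pattern_product E f (\<lambda>v\<in>V. z v) = pattern_product E f z"
  unfolding pattern_product_def by (rule prod.cong) (use assms in auto)

lemma pattern_integral_digit_parts:
  assumes "finite V" "E \<subseteq> V \<times> V" "f \<in> bounded_borel" "g \<in> bounded_borel"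
  shows "(\<integral>z. pattern_product E f (\<lambda>v. digit_part (\<beta> v) (z v)) *
      pattern_product E g (\<lambda>v. digit_part (\<not> \<beta> v) (z v)) \<partial>unit_cube V) =
    pattern_integral V E f * pattern_integral V E g"
proof -
  obtain C where f: "f \<in> borel_measurable borel" "\<forall>p. \<bar>f p\<bar> \<le> C" "0 \<le> C"
    using assms(3) by (rule bounded_borelE)
  obtain D where g: "g \<in> borel_measurable borel" "\<forall>p. \<bar>g p\<bar> \<le> D" "0 \<le> D"
    using assms(4) by (rule bounded_borelE)
  have "\<bar>pattern_product E f z\<bar> \<le> C ^ card E" "\<bar>pattern_product E g z\<bar> \<le> D ^ card E" for z
    using f(2) g(2) by (intro pattern_product_le; blast)+
  note bounds = this
  show ?thesis
    using integral_digit_parts[OF assms(1) measurable_pattern_product[OF assms(2) f(1)] bounds(1)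
        measurable_pattern_product[OF assms(2) g(1)] bounds(2), of \<beta>]
    by (simp add: pattern_integral_def pattern_product_restrict[OF assms(2)])
qed

text \<open>With a constant choice of digits, \<open>f\<close> reads the even digits at all vertices
  and \<open>g\<close> the odd ones.\<close>

lemma pattern_integral_tensor:
  assumes "finite V" "E \<subseteq> V \<times> V" "f \<in> bounded_borel" "g \<in> bounded_borel"
  shows "pattern_integral V E (tensor_fun f g) = pattern_integral V E f * pattern_integral V E g"
  using pattern_integral_digit_parts[OF assms, of "\<lambda>_. True"]
  by (simp add: pattern_integral_def pattern_product_def tensor_fun_def prod.distrib)

text \<open>
  In a product over the edges of a bipartite graph, the two factors of \<^const>\<open>twist_fun\<close> depend on
  disjoint families of independent digits.
\<close>

lemma pattern_integral_twist:
  assumes "finite A" "finite B" "A \<inter> B = {}" "E \<subseteq> A \<times> B" "f \<in> bounded_borel"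
  shows "pattern_integral (A \<union> B) E (twist_fun f) =
    pattern_integral (A \<union> B) E f * pattern_integral (A \<union> B) E (transpose_fun f)"
proof -
  have E: "E \<subseteq> (A \<union> B) \<times> (A \<union> B)"
    using assms(4) by auto
  \<comment> \<open>Even digits on \<open>A\<close> and odd digits on \<open>B\<close> feed the
    first factor; the complementary digits feed the second, with its arguments exchanged.\<close>
  have "pattern_product E (twist_fun f) z = pattern_product E f (\<lambda>v. digit_part (v \<in> A) (z v)) *
      pattern_product E (transpose_fun f) (\<lambda>v. digit_part (v \<notin> A) (z v))" for z
    unfolding pattern_product_def twist_fun_def transpose_fun_def prod.distrib[symmetric]
  proof (rule prod.cong[OF refl])
    fix e assume "e \<in> E"
    then have "fst e \<in> A" "snd e \<in> B"
      using assms(4) by auto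
    then have "(fst e \<in> A) = True" "(snd e \<in> A) = False"
      using assms(3) by auto
    then show "f (digit_part True (fst (z (fst e), z (snd e))), digit_part False (snd (z (fst e), z (snd e)))) *
        f (digit_part True (snd (z (fst e), z (snd e))), digit_part False (fst (z (fst e), z (snd e)))) =
        f (digit_part (fst e \<in> A) (z (fst e)), digit_part (snd e \<in> A) (z (snd e))) *
        f (snd (digit_part (fst e \<notin> A) (z (fst e)), digit_part (snd e \<notin> A) (z (snd e))),
          fst (digit_part (fst e \<notin> A) (z (fst e)), digit_part (snd e \<notin> A) (z (snd e))))"
      by (simp only: fst_conv snd_conv not_True_eq_False not_False_eq_True)
  qed
  then show ?thesis
    using pattern_integral_digit_parts[OF _ E assms(5) bounded_borel_transpose[OF assms(5)], of "\<lambda>v. v \<in> A"]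
      assms(1,2)
    by (simp add: pattern_integral_def)
qed

section \<open>Null sets of the square and of the cube\<close>

lemma edge_distr:
  assumes "finite V" "u \<in> V" "v \<in> V" "u \<noteq> v"
  shows "distr (unit_cube V) borel (\<lambda>z. (z u, z v)) = density lborel (indicator unit_square)"
proof -
  interpret U: prob_space unit_uniform by (rule prob_space_unit_uniform)
  interpret product_sigma_finite "\<lambda>_::'a. unit_uniform" ..
  \<comment> \<open>The uniform law as a density on the whole line, so that its sigma-algebra is the
    full Borel one.\<close>
  interpret L: prob_space "density lborel (indicator {0..1::real})"
    by (rule prob_spaceI) (simp add: emeasure_density nn_integral_indicator)
  have sets: "sets (density lborel (indicator {0..1::real}) \<Otimes>\<^sub>M density lborel (indicator {0..1::real})) =
      sets borel"
    by (subst borel_prod[symmetric]) (intro sets_pair_measure_cong; simp)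
  have "density lborel (indicator {0..1::real}) \<Otimes>\<^sub>M density lborel (indicator {0..1::real}) =
      distr (unit_cube V) borel (\<lambda>z. (z u, z v))"
  proof (rule pair_measure_eqI)
    fix X Y :: "real set"
    assume "X \<in> sets (density lborel (indicator {0..1::real}))" "Y \<in> sets (density lborel (indicator {0..1::real}))"
    then have XY: "X \<in> sets borel" "Y \<in> sets borel" by auto
    have XY': "X \<inter> {0..1} \<in> sets unit_uniform" "Y \<inter> {0..1} \<in> sets unit_uniform"
      using XY by (auto simp: unit_uniform_def sets_restrict_space_iff)
    have dens: "emeasure (density lborel (indicator {0..1::real})) Z = emeasure unit_uniform (Z \<inter> {0..1})"
      if "Z \<in> sets borel" for Z
      using that by (simp add: emeasure_unit_uniform emeasure_density nn_integral_indicator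
          indicator_inter_arith[symmetric] Int_commute)
    \<comment> \<open>The sides of the box that is the preimage of \<open>X \<times> Y\<close>; the
      coordinates other than \<open>u\<close> and \<open>v\<close> contribute the factor 1.\<close>
    define W where "W w = (if w = u then X \<inter> {0..1} else if w = v then Y \<inter> {0..1} else {0..1})" for w
    have "emeasure (distr (unit_cube V) borel (\<lambda>z. (z u, z v))) (X \<times> Y) =
        emeasure (unit_cube V) ((\<lambda>z. (z u, z v)) -` (X \<times> Y) \<inter> space (unit_cube V))"
      using XY by (intro emeasure_distr measurable_edge assms) (simp add: borel_prod[symmetric])
    also have "(\<lambda>z. (z u, z v)) -` (X \<times> Y) \<inter> space (unit_cube V) = Pi\<^sub>E V W"
      using assms by (auto simp: W_def space_unit_cube PiE_iff split: if_splits)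
    also have "emeasure (unit_cube V) \<dots> = (\<Prod>w\<in>V. emeasure unit_uniform (W w))"
      unfolding unit_cube_def using XY' sets.top[of unit_uniform]
      by (intro emeasure_PiM assms) (auto simp: W_def)
    also have "\<dots> = (\<Prod>w\<in>{u, v}. emeasure unit_uniform (W w))"
      using U.emeasure_space_1 assms by (intro prod.mono_neutral_right) (auto simp: W_def)
    also have "\<dots> = emeasure unit_uniform (X \<inter> {0..1}) * emeasure unit_uniform (Y \<inter> {0..1})"
      using assms(4) by (simp add: W_def)
    finally show "emeasure (density lborel (indicator {0..1})) X * emeasure (density lborel (indicator {0..1})) Y =
        emeasure (distr (unit_cube V) borel (\<lambda>z. (z u, z v))) (X \<times> Y)"
      by (simp add: dens XY)
  qed (use sets L.sigma_finite_measure_axioms in auto)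
  moreover have "density lborel (indicator {0..1::real}) \<Otimes>\<^sub>M density lborel (indicator {0..1::real}) =
      density (lborel \<Otimes>\<^sub>M lborel) (\<lambda>(x, y). indicator {0..1} x * indicator {0..1} y)"
    by (rule pair_measure_density)
      (auto intro: L.sigma_finite_measure_axioms lborel.sigma_finite_measure_axioms)
  moreover have "(\<lambda>(x, y). indicator {0..1} x * indicator {0..1} y) =
      (indicator unit_square :: real \<times> real \<Rightarrow> ennreal)"
    by (auto simp: fun_eq_iff indicator_def)
  ultimately show ?thesis
    by (simp add: lborel_prod)
qed

lemma unit_square_borel: "unit_square \<in> sets borel"
  by (simp add: borel_prod[symmetric])

lemma AE_unit_square_iff:
  "(AE p in lebesgue_on unit_square. P p) \<longleftrightarrow> (AE p in density lborel (indicator unit_square). P p)"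
proof -
  have "(AE p in lebesgue_on unit_square. P p) \<longleftrightarrow> (AE p in lborel. p \<in> unit_square \<longrightarrow> P p)"
    using unit_square_borel by (subst AE_restrict_space_iff) (auto simp: AE_completion_iff)
  also have "\<dots> \<longleftrightarrow> (AE p in density lborel (indicator unit_square). P p)"
    using unit_square_borel by (subst AE_density) (auto simp: indicator_def)
  finally show ?thesis .
qed

lemma AE_edge:
  assumes "finite V" "u \<in> V" "v \<in> V" "u \<noteq> v" "AE p in lebesgue_on unit_square. P p"
  shows "AE z in unit_cube V. P (z u, z v)"
  using assms(5) unfolding AE_unit_square_iff edge_distr[OF assms(1-4), symmetric]
  by (rule AE_distrD[OF measurable_edge[OF assms(2,3)]])

text \<open>By \<open>edge_distr\<close>, the integral over a single edge is the \<open>L^1\<close>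
  norm on the square.\<close>

lemma pattern_integral_single_edge:
  assumes "finite V" "u \<in> V" "v \<in> V" "u \<noteq> v" "f \<in> bounded_borel"
    and "pattern_integral V {(u, v)} (\<lambda>p. \<bar>f p\<bar>) = 0"
  shows "AE p in lebesgue_on unit_square. f p = 0"
proof -
  have [measurable]: "f \<in> borel_measurable borel"
    using assms(5) by (rule bounded_borel_measurable)
  let ?M = "distr (unit_cube V) borel (\<lambda>z. (z u, z v))"
  have int: "integrable (unit_cube V) (\<lambda>z. \<bar>f (z u, z v)\<bar>)"
    using integrable_pattern_product[OF _ bounded_borel_abs[OF assms(5)], of "{(u, v)}" V] assms(2,3)
    by (simp add: pattern_product_def[abs_def])
  have "AE p in ?M. \<bar>f p\<bar> = 0"
  proof (subst integral_nonneg_eq_0_iff_AE[symmetric])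
    show "integrable ?M (\<lambda>p. \<bar>f p\<bar>)"
      using int by (subst integrable_distr_eq[OF measurable_edge[OF assms(2,3)]]) auto
    show "(\<integral>p. \<bar>f p\<bar> \<partial>?M) = 0"
      using assms(6) by (subst integral_distr[OF measurable_edge[OF assms(2,3)]])
        (auto simp: pattern_integral_def pattern_product_def)
  qed auto
  then show ?thesis
    unfolding AE_unit_square_iff edge_distr[OF assms(1-4), symmetric] by simp
qed

section \<open>Lebesgue measurable functions and the completed cube\<close>

lemma measurable_completion_cong_AE:
  assumes "g \<in> M \<rightarrow>\<^sub>M N" and AE: "AE x in M. f x = g x" and N: "space N = UNIV"
  shows "f \<in> completion M \<rightarrow>\<^sub>M N"
proof (rule measurableI)
  fix X assume X: "X \<in> sets N"
  have "{x \<in> space (completion M). g x \<in> X} \<in> sets (completion M)"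
    using measurable_sets[OF measurable_completion[OF assms(1)] X] by (simp add: vimage_def Int_def conj_commute)
  \<comment> \<open>\<open>f\<close> and \<open>g\<close> differ on a null set, all of whose subsets
    are measurable in the completion. The preimage under \<open>f\<close> is the one under
    \<open>g\<close>, corrected by two such subsets.\<close>
  moreover have diff: "{x \<in> space (completion M). f x \<noteq> g x \<and> P x} \<in> sets (completion M)" for P
  proof -
    have "AE x in M. \<not> (f x \<noteq> g x \<and> P x)"
      using AE by eventually_elim simp
    from sets_completion_AE[OF this] show ?thesis
      unfolding pred_def by simp
  qed
  ultimately have "({x \<in> space (completion M). g x \<in> X} - {x \<in> space (completion M). f x \<noteq> g x \<and> True}) \<union>
      {x \<in> space (completion M). f x \<noteq> g x \<and> f x \<in> X} \<in> sets (completion M)"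
    by (intro sets.Un sets.Diff)
  also have "({x \<in> space (completion M). g x \<in> X} - {x \<in> space (completion M). f x \<noteq> g x \<and> True}) \<union>
      {x \<in> space (completion M). f x \<noteq> g x \<and> f x \<in> X} = f -` X \<inter> space (completion M)"
    by auto
  finally show "f -` X \<inter> space (completion M) \<in> sets (completion M)" .
qed (simp add: N)

text \<open>The ends of an edge are distinct coordinates, so by \<open>AE_edge\<close> a change on a
  null set of the square alters each of the finitely many factors only on a null set of the
  cube.\<close>

lemma hom_integral_eq_pattern_integral:
  assumes "bipartite_graph A B E" "g \<in> bounded_borel" "AE p in lebesgue_on unit_square. f p = g p"
  shows "hom_integral A B E f = pattern_integral (A \<union> B) E g"
proof -
  interpret bipartite_graph A B E by fact
  have fin: "finite (A \<union> B)" "finite E"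
    using finite_parts edges finite_subset[OF edges] by auto
  have E: "E \<subseteq> (A \<union> B) \<times> (A \<union> B)" "\<And>e. e \<in> E \<Longrightarrow> fst e \<noteq> snd e"
    using edges disjoint_parts by auto
  have g: "pattern_product E g \<in> borel_measurable (unit_cube (A \<union> B))"
    using assms(2) E by (auto intro: measurable_pattern_product bounded_borel_measurable)
  have "AE z in unit_cube (A \<union> B). \<forall>e\<in>E. f (z (fst e), z (snd e)) = g (z (fst e), z (snd e))"
    using fin E by (auto simp: AE_finite_all intro!: AE_edge assms(3))
  then have AE: "AE z in unit_cube (A \<union> B). pattern_product E f z = pattern_product E g z"
    by eventually_elim (simp add: pattern_product_def)
  have "hom_integral A B E f = (\<integral>z. pattern_product E f z \<partial>completion (unit_cube (A \<union> B)))"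
    by (simp add: hom_integral_def cube_measure_def unit_cube_def unit_uniform_def pattern_product_def
        case_prod_unfold)
  also have "\<dots> = (\<integral>z. pattern_product E g z \<partial>completion (unit_cube (A \<union> B)))"
    using AE g by (intro integral_cong_AE measurable_completion_cong_AE[OF g] AE_completion
        measurable_completion) auto
  also have "\<dots> = pattern_integral (A \<union> B) E g"
    unfolding pattern_integral_def by (rule integral_completion[OF g])
  finally show ?thesis .
qed

lemma bounded_measurable_borel_representative:
  assumes "f \<in> bounded_measurable"
  obtains g where "g \<in> bounded_borel" "AE p in lebesgue_on unit_square. f p = g p"
proof -
  obtain C where C: "\<And>p. p \<in> unit_square \<Longrightarrow> \<bar>f p\<bar> \<le> C"
    using assms by (auto simp: bounded_measurable_def bounded_iff)
  have "(\<lambda>p. indicator unit_square p * f p) \<in> borel_measurable lebesgue"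
    using assms unit_square_borel
      borel_measurable_restrict_space_iff[of unit_square lebesgue f]
    by (auto simp: bounded_measurable_def)
  then obtain h where h: "h \<in> borel_measurable lborel" "AE p in lborel. indicator unit_square p * f p = h p"
    using completion_ex_borel_measurable_real by blast
  \<comment> \<open>Clamping changes nothing almost everywhere on the square and gives a bound on
    the whole plane.\<close>
  have "(\<lambda>p. max (- C) (min C (h p))) \<in> bounded_borel"
    using h(1) by (intro bounded_borelI[where C = "\<bar>C\<bar>"]) auto
  moreover have "AE p in lborel. p \<in> unit_square \<longrightarrow> f p = max (- C) (min C (h p))"
    using h(2)
  proof eventually_elim
    case (elim p)
    then show ?case
      using C[of p] by (auto simp: max_def min_def abs_le_iff)
  qed
  then have "AE p in lebesgue_on unit_square. f p = max (- C) (min C (h p))"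
    using unit_square_borel by (subst AE_restrict_space_iff) (auto simp: AE_completion_iff)
  ultimately show ?thesis
    by (rule that)
qed

lemma bounded_borel_imp_bounded_measurable: "bounded_borel \<subseteq> bounded_measurable"
proof
  fix f assume "f \<in> bounded_borel"
  then obtain C where "f \<in> borel_measurable borel" "\<forall>p. \<bar>f p\<bar> \<le> C" "0 \<le> C"
    by (rule bounded_borelE)
  then show "f \<in> bounded_measurable"
    by (auto simp: bounded_measurable_def bounded_iff
        intro!: measurable_restrict_space1 measurable_completion)
qed

section \<open>From symmetric to arbitrary functions\<close>

text \<open>Induction along a path in the symmetric closure: \<open>c\<close> agrees across an edge
  in either direction.\<close>

lemma connected_colouring_constant:
  assumes "bipartite_connected A B E" "\<And>e. e \<in> E \<Longrightarrow> c (fst e) = c (snd e)"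
    and "x \<in> A \<union> B" "y \<in> A \<union> B"
  shows "c x = c y"
proof -
  let ?G = "with_proj \<lparr>pverts = A \<union> B, parcs = E\<rparr>"
  have "(x, y) \<in> rtrancl_on (verts (with_proj (mk_symmetric ?G))) (arcs_ends (with_proj (mk_symmetric ?G)))"
    using assms(1,3,4)
    by (auto simp: bipartite_connected_def Digraph_Component.connected_def strongly_connected_def
        reachable_def mk_symmetric_def)
  then show ?thesis
    by (induction rule: rtrancl_on_induct)
      (use assms(2) in \<open>fastforce simp: arcs_ends_def arc_to_ends_def mk_symmetric_def\<close>)+
qed

section \<open>Functions supported on the off-diagonal blocks\<close>

definition half_block :: "real \<times> real \<Rightarrow> real" where
  "half_block p = of_bool (fst p < 1/2 \<and> 1/2 \<le> snd p)"

text \<open>\<open>digit_part False\<close> of a coordinate decides its half, and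
  \<open>digit_part True\<close> is the argument passed on. Thus \<open>f\<close> sits on the block
  from the lower to the upper half, and \<open>g\<close> on the opposite one.\<close>

definition block_fun :: "(real \<times> real \<Rightarrow> real) \<Rightarrow> (real \<times> real \<Rightarrow> real) \<Rightarrow> real \<times> real \<Rightarrow> real" where
  "block_fun f g p = tensor_fun f half_block p + tensor_fun g (transpose_fun half_block) p"

lemma bounded_borel_half_block: "half_block \<in> bounded_borel"
proof (rule bounded_borelI[where C = 1])
  have [measurable]: "fst \<in> borel_measurable (borel :: (real \<times> real) measure)"
    "snd \<in> borel_measurable (borel :: (real \<times> real) measure)"
    by (fact borel_measurable_fst borel_measurable_snd)+
  show "half_block \<in> borel_measurable borel"
    unfolding half_block_def[abs_def] by measurable
qed (simp add: half_block_def)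

lemma bounded_borel_block:
  "f \<in> bounded_borel \<Longrightarrow> g \<in> bounded_borel \<Longrightarrow> block_fun f g \<in> bounded_borel"
  unfolding block_fun_def[abs_def]
  by (intro bounded_borel_add bounded_borel_tensor bounded_borel_half_block bounded_borel_transpose)

lemma transpose_transpose: "transpose_fun (transpose_fun f) = f"
  by (simp add: transpose_fun_def fun_eq_iff)

lemma transpose_tensor:
  "transpose_fun (tensor_fun f g) = tensor_fun (transpose_fun f) (transpose_fun g)"
  by (simp add: transpose_fun_def tensor_fun_def fun_eq_iff)

lemma transpose_twist: "transpose_fun (twist_fun f) = twist_fun f"
  by (simp add: transpose_fun_def twist_fun_def fun_eq_iff)

lemma transpose_block: "transpose_fun (block_fun f g) = block_fun (transpose_fun g) (transpose_fun f)"
  by (simp add: block_fun_def tensor_fun_def transpose_fun_def fun_eq_iff)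

lemma pattern_integral_const_one: "pattern_integral V E (\<lambda>p. 1) = 1"
proof -
  interpret prob_space "unit_cube V" by (rule prob_space_unit_cube)
  show ?thesis
    by (simp add: pattern_integral_def pattern_product_def prob_space)
qed

lemma pattern_integral_nonneg: "(\<And>p. 0 \<le> f p) \<Longrightarrow> 0 \<le> pattern_integral V E f"
  unfolding pattern_integral_def pattern_product_def
  by (intro Bochner_Integration.integral_nonneg prod_nonneg) auto

text \<open>
  A point contributes to the integral of \<^const>\<open>block_fun\<close> only if every edge joins the two halves
  of the unit interval, and connectedness then forces all edges to do so in the same direction.
\<close>

lemma pattern_product_block:
  assumes "bipartite_connected A B E" "E \<subseteq> A \<times> B" "A \<inter> B = {}" "E \<noteq> {}" "finite E"
  shows "pattern_product E (block_fun f g) z =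
    pattern_product E (tensor_fun f half_block) z +
    pattern_product E (tensor_fun g (transpose_fun half_block)) z"
proof -
  define low where "low w \<longleftrightarrow> digit_part False (z w) < 1/2" for w
  define F where "F e = tensor_fun f half_block (z (fst e), z (snd e))" for e
  define G where "G e = tensor_fun g (transpose_fun half_block) (z (fst e), z (snd e))" for e
  have F: "F e = 0" if "\<not> (low (fst e) \<and> \<not> low (snd e))" for e
    using that by (auto simp: F_def tensor_fun_def half_block_def low_def)
  have G: "G e = 0" if "\<not> (low (snd e) \<and> \<not> low (fst e))" for e
    using that by (auto simp: G_def tensor_fun_def half_block_def transpose_fun_def low_def)
  have "(\<Prod>e\<in>E. F e + G e) = (\<Prod>e\<in>E. F e) + (\<Prod>e\<in>E. G e)"
  proof (cases "\<exists>e\<in>E. low (fst e) = low (snd e)")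
    case True
    \<comment> \<open>An edge inside one half has both factors zero and annihilates all three
      products.\<close>
    then obtain e where e: "e \<in> E" "F e = 0" "G e = 0"
      using F G by metis
    then have "(\<Prod>e\<in>E. F e + G e) = 0" "(\<Prod>e\<in>E. F e) = 0" "(\<Prod>e\<in>E. G e) = 0"
      using assms(5) by (auto simp: prod_zero_iff intro!: bexI[of _ e])
    then show ?thesis by simp
  next
    case False
    have A: "fst e \<in> A" "snd e \<notin> A" "fst e \<in> A \<union> B" if "e \<in> E" for e
    proof -
      have "fst e \<in> A" "snd e \<in> B"
        using assms(2) that by auto
      then show "fst e \<in> A" "snd e \<notin> A" "fst e \<in> A \<union> B"
        using assms(3) by auto
    qed
    \<comment> \<open>When every edge crosses, \<open>low\<close> and membership in \<open>A\<close>
      both flip along each edge, so their agreement is constant on the connected graph.\<close>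
    have const: "(low (fst e) \<longleftrightarrow> fst e \<in> A) \<longleftrightarrow> (low (fst e') \<longleftrightarrow> fst e' \<in> A)"
      if "e \<in> E" "e' \<in> E" for e e'
      by (rule connected_colouring_constant[OF assms(1), where c = "\<lambda>w. low w \<longleftrightarrow> w \<in> A"])
        (use A False that in auto)
    obtain e0 where e0: "e0 \<in> E"
      using assms(4) by auto
    \<comment> \<open>The direction of \<open>e0\<close> is that of all edges, so one kind of factor
      vanishes throughout; its product is 0 and not the empty product 1, as \<open>E\<close> is
      nonempty.\<close>
    show ?thesis
    proof (cases "low (fst e0)")
      case True
      then have "G e = 0" if "e \<in> E" for e
        using const[OF e0 that] A e0 that by (intro G) auto
      then show ?thesis
        using assms(4,5) by (simp add: prod_zero_iff card_gt_0_iff)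
    next
      case low: False
      then have "F e = 0" if "e \<in> E" for e
        using const[OF e0 that] A e0 that by (intro F) auto
      then show ?thesis
        using assms(4,5) by (simp add: prod_zero_iff card_gt_0_iff)
    qed
  qed
  then show ?thesis
    by (simp add: pattern_product_def block_fun_def F_def G_def)
qed

text \<open>The integrals of \<open>half_block\<close> and its transpose are the constants
  \<open>b\<close> and \<open>b'\<close>, the same for all \<open>f\<close> and
  \<open>g\<close>.\<close>

lemma pattern_integral_block:
  assumes "bipartite_graph A B E" "bipartite_connected A B E" "f \<in> bounded_borel" "g \<in> bounded_borel"
  shows "pattern_integral (A \<union> B) E (block_fun f g) =
    pattern_integral (A \<union> B) E f * pattern_integral (A \<union> B) E half_block +
    pattern_integral (A \<union> B) E g * pattern_integral (A \<union> B) E (transpose_fun half_block)"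
proof -
  interpret bipartite_graph A B E by fact
  have E: "E \<subseteq> (A \<union> B) \<times> (A \<union> B)" "finite (A \<union> B)" "finite E" "E \<noteq> {}"
    using edges finite_parts nonempty no_isolated finite_subset[OF edges] by auto
  have b: "half_block \<in> bounded_borel" "transpose_fun half_block \<in> bounded_borel"
    by (intro bounded_borel_half_block bounded_borel_transpose)+
  have "pattern_integral (A \<union> B) E (block_fun f g) =
      (\<integral>z. pattern_product E (tensor_fun f half_block) z +
        pattern_product E (tensor_fun g (transpose_fun half_block)) z \<partial>unit_cube (A \<union> B))"
    unfolding pattern_integral_def
    by (intro Bochner_Integration.integral_cong refl
        pattern_product_block[OF assms(2) edges disjoint_parts E(4,3)])
  also have "\<dots> = pattern_integral (A \<union> B) E (tensor_fun f half_block) +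
      pattern_integral (A \<union> B) E (tensor_fun g (transpose_fun half_block))"
    unfolding pattern_integral_def
    by (intro Bochner_Integration.integral_add integrable_pattern_product E bounded_borel_tensor assms b)
  finally show ?thesis
    by (simp add: pattern_integral_tensor[OF E(2,1)] assms b)
qed

text \<open>
  The case \<open>\<kappa> = id\<close> is about real-norming graphs, the case \<open>\<kappa> = abs\<close> about weakly norming ones.
\<close>

locale symmetric_norming =
  fixes A B :: "'v set" and E :: "('v \<times> 'v) set" and \<kappa> :: "real \<Rightarrow> real"
  assumes graph: "bipartite_graph A B E" and connected: "bipartite_connected A B E"
    and \<kappa>: "\<kappa> = id \<or> \<kappa> = abs"
    and sym_triangle: "\<And>f g. f \<in> bounded_borel \<Longrightarrow> g \<in> bounded_borel \<Longrightarrow>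
      transpose_fun f = f \<Longrightarrow> transpose_fun g = g \<Longrightarrow>
      \<bar>pattern_integral (A \<union> B) E (\<lambda>p. \<kappa> (f p + g p))\<bar> powr (1 / real (card E)) \<le>
      \<bar>pattern_integral (A \<union> B) E (\<lambda>p. \<kappa> (f p))\<bar> powr (1 / real (card E)) +
      \<bar>pattern_integral (A \<union> B) E (\<lambda>p. \<kappa> (g p))\<bar> powr (1 / real (card E))"
    and sym_definite: "\<And>f. f \<in> bounded_borel \<Longrightarrow> transpose_fun f = f \<Longrightarrow>
      pattern_integral (A \<union> B) E (\<lambda>p. \<kappa> (f p)) = 0 \<Longrightarrow> AE p in lebesgue_on unit_square. f p = 0"
begin

sublocale bipartite_graph A B E by (rule graph)

section \<open>The functional \<open>t\<close> on the constructed functions\<close>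

definition t :: "(real \<times> real \<Rightarrow> real) \<Rightarrow> real" where
  "t f = pattern_integral (A \<union> B) E (\<lambda>p. \<kappa> (f p))"

lemma E_facts: "E \<subseteq> (A \<union> B) \<times> (A \<union> B)" "finite (A \<union> B)" "finite E" "E \<noteq> {}" "0 < card E"
proof -
  show *: "E \<subseteq> (A \<union> B) \<times> (A \<union> B)" "finite (A \<union> B)" "finite E" "E \<noteq> {}"
    using edges finite_parts nonempty no_isolated finite_subset[OF edges] by auto
  then show "0 < card E" by (simp add: card_gt_0_iff)
qed

text \<open>These properties, shared by \<open>id\<close> and \<open>abs\<close>, make
  \<open>\<kappa>\<close> commute with tensor products and twists.\<close>

lemma \<kappa>_simps: "\<kappa> (x * y) = \<kappa> x * \<kappa> y" "\<kappa> (of_bool b) = of_bool b" "\<kappa> 0 = 0" "\<kappa> 1 = 1"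
  using \<kappa> by (auto simp: abs_mult)

lemma bounded_borel_\<kappa>: "f \<in> bounded_borel \<Longrightarrow> (\<lambda>p. \<kappa> (f p)) \<in> bounded_borel"
  using \<kappa> bounded_borel_abs by (auto simp: id_def)

lemma \<kappa>_tensor: "(\<lambda>p. \<kappa> (tensor_fun f g p)) = tensor_fun (\<lambda>p. \<kappa> (f p)) (\<lambda>p. \<kappa> (g p))"
  by (simp add: tensor_fun_def fun_eq_iff \<kappa>_simps)

lemma \<kappa>_twist: "(\<lambda>p. \<kappa> (twist_fun f p)) = twist_fun (\<lambda>p. \<kappa> (f p))"
  by (simp add: twist_fun_def fun_eq_iff \<kappa>_simps)

lemma \<kappa>_transpose: "(\<lambda>p. \<kappa> (transpose_fun f p)) = transpose_fun (\<lambda>p. \<kappa> (f p))"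
  by (simp add: transpose_fun_def fun_eq_iff)

text \<open>The blocks are disjoint: at every point at most one summand is nonzero, so even
  \<open>abs\<close> is additive here.\<close>

lemma \<kappa>_block: "(\<lambda>p. \<kappa> (block_fun f g p)) = block_fun (\<lambda>p. \<kappa> (f p)) (\<lambda>p. \<kappa> (g p))"
proof
  show "\<kappa> (block_fun f g p) = block_fun (\<lambda>p. \<kappa> (f p)) (\<lambda>p. \<kappa> (g p)) p" for p
    by (cases "digit_part False (fst p) < 1/2"; cases "digit_part False (snd p) < 1/2")
      (simp_all add: block_fun_def tensor_fun_def half_block_def transpose_fun_def \<kappa>_simps)
qed

lemma t_tensor: "f \<in> bounded_borel \<Longrightarrow> g \<in> bounded_borel \<Longrightarrow> t (tensor_fun f g) = t f * t g"
  by (simp add: t_def \<kappa>_tensor pattern_integral_tensor[OF E_facts(2,1)] bounded_borel_\<kappa>)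

lemma t_twist: "f \<in> bounded_borel \<Longrightarrow> t (twist_fun f) = t f * t (transpose_fun f)"
  by (simp add: t_def \<kappa>_twist \<kappa>_transpose pattern_integral_twist finite_parts disjoint_parts edges
      bounded_borel_\<kappa>)

lemma t_half_block:
  "t half_block = pattern_integral (A \<union> B) E half_block"
  "t (transpose_fun half_block) = pattern_integral (A \<union> B) E (transpose_fun half_block)"
  by (simp_all add: t_def half_block_def[abs_def] transpose_fun_def[abs_def] \<kappa>_simps)

lemma t_block:
  "f \<in> bounded_borel \<Longrightarrow> g \<in> bounded_borel \<Longrightarrow>
    t (block_fun f g) = t f * t half_block + t g * t (transpose_fun half_block)"
  unfolding t_half_block
  by (simp add: t_def \<kappa>_block pattern_integral_block[OF graph connected] bounded_borel_\<kappa>)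

text \<open>The symmetric function \<open>twist_fun f\<close> has integral
  \<open>t f * t (transpose_fun f) = 0\<close> and so vanishes almost everywhere. Over a single
  edge, its \<open>L^1\<close> norm splits into those of \<open>f\<close> and of its
  transpose.\<close>

lemma definite:
  assumes f: "f \<in> bounded_borel" and "t f = 0"
  shows "AE p in lebesgue_on unit_square. f p = 0"
proof -
  have twist: "AE p in lebesgue_on unit_square. twist_fun f p = 0"
    using t_twist[OF f] assms(2)
    by (intro sym_definite bounded_borel_twist f transpose_twist) (simp add: t_def)
  obtain u v where uv: "(u, v) \<in> E"
    using E_facts(4) by auto
  then have uv': "u \<in> A \<union> B" "v \<in> A \<union> B" "u \<noteq> v" "{(u, v)} \<subseteq> A \<times> B"
    using edges disjoint_parts by auto
  have "AE z in unit_cube (A \<union> B). pattern_product {(u, v)} (\<lambda>p. \<bar>twist_fun f p\<bar>) z = 0"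
    using AE_edge[OF E_facts(2) uv'(1-3) twist] by (simp add: pattern_product_def)
  then have "pattern_integral (A \<union> B) {(u, v)} (\<lambda>p. \<bar>twist_fun f p\<bar>) = 0"
    unfolding pattern_integral_def by (rule integral_eq_zero_AE)
  moreover have "(\<lambda>p. \<bar>twist_fun f p\<bar>) = twist_fun (\<lambda>p. \<bar>f p\<bar>)"
    by (simp add: twist_fun_def fun_eq_iff abs_mult)
  ultimately have "pattern_integral (A \<union> B) {(u, v)} (\<lambda>p. \<bar>f p\<bar>) = 0 \<or>
      pattern_integral (A \<union> B) {(u, v)} (transpose_fun (\<lambda>p. \<bar>f p\<bar>)) = 0"
    by (simp add: pattern_integral_twist[OF finite_parts disjoint_parts uv'(4) bounded_borel_abs[OF f]])
  \<comment> \<open>Transposing the function reverses the edge, and the reversed edge again yields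
    the \<open>L^1\<close> norm of \<open>f\<close>.\<close>
  moreover have "pattern_integral (A \<union> B) {(u, v)} (transpose_fun (\<lambda>p. \<bar>f p\<bar>)) =
      pattern_integral (A \<union> B) {(v, u)} (\<lambda>p. \<bar>f p\<bar>)"
    by (simp add: pattern_integral_def pattern_product_def transpose_fun_def)
  ultimately show ?thesis
    using pattern_integral_single_edge[OF E_facts(2)] uv'(1-3) f by metis
qed

text \<open>\<open>definite\<close> covers the asymmetric \<open>half_block\<close>, which is 1 on a
  nonempty open set. Positivity later permits division by this constant.\<close>

lemma t_half_block_pos: "0 < t half_block"
proof -
  let ?Q = "{0<..<1/2} \<times> {1/2<..<1} :: (real \<times> real) set"
  have "t half_block \<noteq> 0"
  proof
    assume "t half_block = 0"
    then have "AE p in lebesgue_on unit_square. half_block p = 0"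
      by (rule definite[OF bounded_borel_half_block])
    then have "AE p in lebesgue. p \<in> unit_square \<longrightarrow> half_block p = 0"
      using unit_square_borel by (subst (asm) AE_restrict_space_iff) auto
    then have "AE p in lebesgue. p \<notin> ?Q"
      by eventually_elim (auto simp: half_block_def)
    moreover have "open ?Q"
      by (intro open_Times) auto
    ultimately have "negligible ?Q"
      using AE_iff_null_sets[of ?Q lebesgue] by (simp add: negligible_iff_null_sets borel_open)
    moreover have "(1/4, 3/4) \<in> ?Q"
      by simp
    ultimately show False
      using open_not_negligible[OF \<open>open ?Q\<close>] by blast
  qed
  moreover have "0 \<le> t half_block"
    unfolding t_half_block by (rule pattern_integral_nonneg) (simp add: half_block_def)
  ultimately show ?thesis by simp
qed

section \<open>Symmetrization and the triangle inequality\<close>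

definition symmetrize :: "(real \<times> real \<Rightarrow> real) \<Rightarrow> real \<times> real \<Rightarrow> real" where
  "symmetrize f = block_fun f (transpose_fun f)"

text \<open>\<open>symmetrize\<close> is additive and its values are symmetric, so
  \<open>sym_triangle\<close> applies to them.\<close>

lemma symmetrize_triangle:
  assumes "f \<in> bounded_borel" "g \<in> bounded_borel"
  shows "\<bar>t (symmetrize (\<lambda>p. f p + g p))\<bar> powr (1 / real (card E)) \<le>
    \<bar>t (symmetrize f)\<bar> powr (1 / real (card E)) + \<bar>t (symmetrize g)\<bar> powr (1 / real (card E))"
proof -
  have "symmetrize (\<lambda>p. f p + g p) = (\<lambda>p. symmetrize f p + symmetrize g p)"
    by (simp add: symmetrize_def block_fun_def tensor_fun_def transpose_fun_def fun_eq_iff algebra_simps)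
  moreover have "symmetrize f \<in> bounded_borel" "symmetrize g \<in> bounded_borel"
    unfolding symmetrize_def by (intro bounded_borel_block bounded_borel_transpose assms)+
  moreover have "transpose_fun (symmetrize h) = symmetrize h" for h
    by (simp add: symmetrize_def transpose_block transpose_transpose)
  ultimately show ?thesis
    unfolding t_def using sym_triangle[of "symmetrize f" "symmetrize g"] by simp
qed

lemma t_symmetrize:
  "f \<in> bounded_borel \<Longrightarrow>
    t (symmetrize f) = t f * t half_block + t (transpose_fun f) * t (transpose_fun half_block)"
  by (simp add: symmetrize_def t_block bounded_borel_transpose)

text \<open>This is \<open>f\<close> tensored with \<open>k\<close> copies of \<open>g\<close>; as
  \<open>f\<close> occurs once, the result is additive in \<open>f\<close>.\<close>

definition tensor_power :: "(real \<times> real \<Rightarrow> real) \<Rightarrow> nat \<Rightarrow> (real \<times> real \<Rightarrow> real) \<Rightarrow> real \<times> real \<Rightarrow> real" where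
  "tensor_power g k = (\<lambda>f. tensor_fun f g) ^^ k"

lemma tensor_power_simps:
  "tensor_power g 0 f = f" "tensor_power g (Suc k) f = tensor_fun (tensor_power g k f) g"
  by (simp_all add: tensor_power_def)

lemma bounded_borel_tensor_power:
  "f \<in> bounded_borel \<Longrightarrow> g \<in> bounded_borel \<Longrightarrow> tensor_power g k f \<in> bounded_borel"
  by (induction k) (simp_all add: tensor_power_simps bounded_borel_tensor)

lemma tensor_power_add:
  "tensor_power g k (\<lambda>p. f p + h p) = (\<lambda>p. tensor_power g k f p + tensor_power g k h p)"
  by (induction k) (simp_all add: tensor_power_simps tensor_fun_def[abs_def] algebra_simps)

lemma transpose_tensor_power:
  "transpose_fun (tensor_power g k f) = tensor_power (transpose_fun g) k (transpose_fun f)"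
  by (induction k) (simp_all add: tensor_power_simps transpose_tensor)

lemma t_tensor_power:
  "f \<in> bounded_borel \<Longrightarrow> g \<in> bounded_borel \<Longrightarrow> t (tensor_power g k f) = t f * t g ^ k"
  by (induction k) (simp_all add: tensor_power_simps t_tensor bounded_borel_tensor_power)

text \<open>
  Tensoring with a high power of \<open>g\<close> makes the transposed part of the symmetrization negligible.
\<close>

lemma triangle_unbalanced:
  assumes f: "f \<in> bounded_borel" and h: "h \<in> bounded_borel" and g: "g \<in> bounded_borel"
    and less: "\<bar>t (transpose_fun g)\<bar> < \<bar>t g\<bar>"
  shows "\<bar>t (\<lambda>p. f p + h p)\<bar> powr (1 / real (card E)) \<le>
    \<bar>t f\<bar> powr (1 / real (card E)) + \<bar>t h\<bar> powr (1 / real (card E))"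
proof -
  define r where "r = 1 / real (card E)"
  have r: "0 < r"
    using E_facts(5) by (simp add: r_def)
  \<comment> \<open>After division by \<open>t half_block * t g ^ k\<close>, the integral of the
    symmetrized power is \<open>t f\<close> plus a multiple of \<open>q ^ k\<close>;
    \<open>s k f\<close> is the absolute value of this quotient.\<close>
  define q where "q = t (transpose_fun g) / t g"
  define d where "d = t (transpose_fun half_block) / t half_block"
  define s where "s k f = \<bar>t f + t (transpose_fun f) * d * q ^ k\<bar>" for k f
  have "t g \<noteq> 0" using less by auto
  \<comment> \<open>The first factor on the right is the same for all \<open>f\<close> and cancels
    from the triangle inequality.\<close>
  have scale: "\<bar>t (symmetrize (tensor_power g k f))\<bar> powr r =
      (t half_block * \<bar>t g\<bar> ^ k) powr r * s k f powr r" if "f \<in> bounded_borel" for k f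
  proof -
    have "t (symmetrize (tensor_power g k f)) =
        t f * t g ^ k * t half_block + t (transpose_fun f) * t (transpose_fun g) ^ k * t (transpose_fun half_block)"
      using that g by (simp add: t_symmetrize bounded_borel_tensor_power t_tensor_power
          transpose_tensor_power bounded_borel_transpose)
    also have "\<dots> = t half_block * t g ^ k * (t f + t (transpose_fun f) * d * q ^ k)"
      using t_half_block_pos \<open>t g \<noteq> 0\<close> by (simp add: d_def q_def field_simps)
    finally have "\<bar>t (symmetrize (tensor_power g k f))\<bar> = (t half_block * \<bar>t g\<bar> ^ k) * s k f"
      using t_half_block_pos by (simp add: abs_mult s_def power_abs)
    then show ?thesis
      by (simp add: powr_mult)
  qed
  have fh: "(\<lambda>p. f p + h p) \<in> bounded_borel"
    by (intro bounded_borel_add f h)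
  have le: "s k (\<lambda>p. f p + h p) powr r \<le> s k f powr r + s k h powr r" for k
  proof -
    have "(t half_block * \<bar>t g\<bar> ^ k) powr r * s k (\<lambda>p. f p + h p) powr r \<le>
        (t half_block * \<bar>t g\<bar> ^ k) powr r * (s k f powr r + s k h powr r)"
      using symmetrize_triangle[OF bounded_borel_tensor_power[OF f g] bounded_borel_tensor_power[OF h g], of k k]
      unfolding tensor_power_add[symmetric] r_def[symmetric] scale[OF fh] scale[OF f] scale[OF h]
      by (simp only: distrib_left)
    moreover have "0 < (t half_block * \<bar>t g\<bar> ^ k) powr r"
      using t_half_block_pos \<open>t g \<noteq> 0\<close> by simp
    ultimately show ?thesis by simp
  qed
  have lim: "(\<lambda>k. s k f powr r) \<longlonglongrightarrow> \<bar>t f\<bar> powr r" for f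
  proof -
    have "\<bar>q\<bar> < 1"
      using less by (simp add: q_def)
    then have "(\<lambda>k. q ^ k) \<longlonglongrightarrow> 0"
      by (intro LIMSEQ_power_zero) simp
    then have "(\<lambda>k. s k f) \<longlonglongrightarrow> \<bar>t f + t (transpose_fun f) * d * 0\<bar>"
      unfolding s_def by (intro tendsto_rabs tendsto_add tendsto_mult tendsto_const)
    \<comment> \<open>The base may tend to 0; the limit still passes through \<open>powr\<close>, as
      the exponent is positive and the bases are nonnegative.\<close>
    then show ?thesis
      using r by (intro tendsto_powr' tendsto_const) (auto simp: s_def)
  qed
  show ?thesis
    unfolding r_def[symmetric]
    by (rule LIMSEQ_le[OF lim tendsto_add[OF lim lim]]) (use le in auto)
qed

text \<open>
  If transposition preserves \<open>\<bar>t\<bar>\<close>, then it preserves \<open>t\<close> itself: apply the hypothesis also to the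
  function that carries \<open>f\<close> on one block and the constant 1 on the other.
\<close>

lemma triangle_balanced:
  assumes f: "f \<in> bounded_borel" and h: "h \<in> bounded_borel"
    and balanced: "\<And>g. g \<in> bounded_borel \<Longrightarrow> \<bar>t (transpose_fun g)\<bar> = \<bar>t g\<bar>"
  shows "\<bar>t (\<lambda>p. f p + h p)\<bar> powr (1 / real (card E)) \<le>
    \<bar>t f\<bar> powr (1 / real (card E)) + \<bar>t h\<bar> powr (1 / real (card E))"
proof -
  have "0 \<le> t (transpose_fun half_block)"
    unfolding t_half_block by (rule pattern_integral_nonneg) (simp add: half_block_def transpose_fun_def)
  then have half: "t (transpose_fun half_block) = t half_block"
    using balanced[OF bounded_borel_half_block] t_half_block_pos by simp
  have one: "t (\<lambda>p. 1) = 1" "transpose_fun (\<lambda>p. 1) = (\<lambda>p. 1)"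
    by (simp_all add: t_def \<kappa>_simps pattern_integral_const_one transpose_fun_def fun_eq_iff)
  have eq: "t (transpose_fun f) = t f" if f: "f \<in> bounded_borel" for f
  proof -
    have "t (block_fun f (\<lambda>p. 1)) = t half_block * (t f + 1)"
      using f by (simp add: t_block half one bounded_borel_const algebra_simps)
    moreover have "t (transpose_fun (block_fun f (\<lambda>p. 1))) = t half_block * (t (transpose_fun f) + 1)"
      using f by (simp add: transpose_block t_block half one bounded_borel_const bounded_borel_transpose
          algebra_simps)
    \<comment> \<open>Equal absolute values both before and after adding 1 rule out opposite nonzero
      values.\<close>
    ultimately have "\<bar>t (transpose_fun f) + 1\<bar> = \<bar>t f + 1\<bar>"
      using balanced[OF bounded_borel_block[OF f bounded_borel_const[of 1]]] t_half_block_pos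
      by (simp add: abs_mult)
    then show ?thesis
      using balanced[OF f] by linarith
  qed
  \<comment> \<open>The two terms of the symmetrization coincide, and the common positive factor
    cancels.\<close>
  have scale: "\<bar>t (symmetrize f)\<bar> powr r = (2 * t half_block) powr r * \<bar>t f\<bar> powr r"
    if "f \<in> bounded_borel" for f r
  proof -
    have "t (symmetrize f) = (2 * t half_block) * t f"
      using that by (simp add: t_symmetrize eq half)
    then have "\<bar>t (symmetrize f)\<bar> = (2 * t half_block) * \<bar>t f\<bar>"
      using t_half_block_pos by (simp add: abs_mult)
    then show ?thesis
      using t_half_block_pos by (simp add: powr_mult)
  qed
  have "0 < (2 * t half_block) powr (1 / real (card E))"
    using t_half_block_pos by simp
  then show ?thesis
    using symmetrize_triangle[OF f h]
    unfolding scale[OF f] scale[OF h] scale[OF bounded_borel_add[OF f h]] distrib_left[symmetric]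
    by (simp only: mult_le_cancel_left_pos)
qed

text \<open>If balance fails at \<open>g\<close>, then either \<open>g\<close> or its transpose
  satisfies the strict inequality of \<open>triangle_unbalanced\<close>.\<close>

lemma triangle:
  assumes "f \<in> bounded_borel" "h \<in> bounded_borel"
  shows "\<bar>t (\<lambda>p. f p + h p)\<bar> powr (1 / real (card E)) \<le>
    \<bar>t f\<bar> powr (1 / real (card E)) + \<bar>t h\<bar> powr (1 / real (card E))"
proof (cases "\<exists>g\<in>bounded_borel. \<bar>t (transpose_fun g)\<bar> \<noteq> \<bar>t g\<bar>")
  case True
  then obtain g where g: "g \<in> bounded_borel" "\<bar>t (transpose_fun g)\<bar> \<noteq> \<bar>t g\<bar>" by blast
  show ?thesis
  proof (cases "\<bar>t (transpose_fun g)\<bar> < \<bar>t g\<bar>")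
    case True
    then show ?thesis
      by (rule triangle_unbalanced[OF assms g(1)])
  next
    case False
    then show ?thesis
      using g by (intro triangle_unbalanced[OF assms bounded_borel_transpose[OF g(1)]])
        (simp add: transpose_transpose)
  qed
next
  case False
  then show ?thesis
    by (intro triangle_balanced[OF assms]) auto
qed

end

section \<open>Transfer to all bounded measurable functions\<close>

lemma norm_on_asymmetric:
  fixes A B :: "'v set"
  assumes graph: "bipartite_graph A B E" and connected: "bipartite_connected A B E"
    and \<kappa>: "\<kappa> = id \<or> \<kappa> = abs"
    and norm: "norm_on bounded_measurable_sym
      (\<lambda>f. \<bar>hom_integral A B E (\<lambda>p. \<kappa> (f p))\<bar> powr (1 / real (card E)))"
  shows "norm_on bounded_measurable
      (\<lambda>f. \<bar>hom_integral A B E (\<lambda>p. \<kappa> (f p))\<bar> powr (1 / real (card E)))"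
proof -
  interpret bipartite_graph A B E by fact
  define r where "r = 1 / real (card E)"
  have card: "0 < card E"
    using edges finite_parts nonempty no_isolated finite_subset[OF edges] by (auto simp: card_gt_0_iff)
  have \<kappa>_bounded: "(\<lambda>p. \<kappa> (f p)) \<in> bounded_borel" if "f \<in> bounded_borel" for f
    using \<kappa> bounded_borel_abs that by (auto simp: id_def)
  have hom: "hom_integral A B E (\<lambda>p. \<kappa> (f p)) = pattern_integral (A \<union> B) E (\<lambda>p. \<kappa> (g p))"
    if "g \<in> bounded_borel" "AE p in lebesgue_on unit_square. f p = g p" for f g
  proof (rule hom_integral_eq_pattern_integral[OF graph \<kappa>_bounded[OF that(1)]])
    show "AE p in lebesgue_on unit_square. \<kappa> (f p) = \<kappa> (g p)"
      using that(2) by eventually_elim simp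
  qed
  have sym: "f \<in> bounded_measurable_sym" if "f \<in> bounded_borel" "transpose_fun f = f" for f
    using that bounded_borel_imp_bounded_measurable
    by (auto simp: bounded_measurable_sym_def transpose_fun_def fun_eq_iff)
  interpret symmetric_norming A B E \<kappa>
  proof
    fix f g
    assume fg: "f \<in> bounded_borel" "g \<in> bounded_borel" "transpose_fun f = f" "transpose_fun g = g"
    have "\<bar>hom_integral A B E (\<lambda>p. \<kappa> (f p + g p))\<bar> powr (1 / real (card E)) \<le>
        \<bar>hom_integral A B E (\<lambda>p. \<kappa> (f p))\<bar> powr (1 / real (card E)) +
        \<bar>hom_integral A B E (\<lambda>p. \<kappa> (g p))\<bar> powr (1 / real (card E))"
      using norm sym[OF fg(1,3)] sym[OF fg(2,4)] unfolding norm_on_def seminorm_on_def by blast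
    then show "\<bar>pattern_integral (A \<union> B) E (\<lambda>p. \<kappa> (f p + g p))\<bar> powr (1 / real (card E)) \<le>
        \<bar>pattern_integral (A \<union> B) E (\<lambda>p. \<kappa> (f p))\<bar> powr (1 / real (card E)) +
        \<bar>pattern_integral (A \<union> B) E (\<lambda>p. \<kappa> (g p))\<bar> powr (1 / real (card E))"
      using hom[OF fg(1)] hom[OF fg(2)] hom[OF bounded_borel_add[OF fg(1,2)]] by simp
  next
    fix f
    assume f: "f \<in> bounded_borel" "transpose_fun f = f" "pattern_integral (A \<union> B) E (\<lambda>p. \<kappa> (f p)) = 0"
    then have "\<bar>hom_integral A B E (\<lambda>p. \<kappa> (f p))\<bar> powr (1 / real (card E)) = 0"
      using hom[OF f(1)] by simp
    then show "AE p in lebesgue_on unit_square. f p = 0"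
      using norm sym[OF f(1,2)] unfolding norm_on_def by blast
  qed (fact graph connected \<kappa>)+
  \<comment> \<open>Each of the \<open>card E\<close> factors picks up \<open>\<kappa> c\<close>,
    and the exponent \<open>r\<close> undoes this power.\<close>
  have scale: "\<bar>hom_integral A B E (\<lambda>p. \<kappa> (c * f p))\<bar> powr r =
      \<bar>c\<bar> * \<bar>hom_integral A B E (\<lambda>p. \<kappa> (f p))\<bar> powr r" for c f
  proof -
    have "hom_integral A B E (\<lambda>p. \<kappa> (c * f p)) = \<kappa> c ^ card E * hom_integral A B E (\<lambda>p. \<kappa> (f p))"
      by (simp add: hom_integral_def \<kappa>_simps case_prod_unfold prod.distrib)
    moreover have "\<bar>\<kappa> c\<bar> = \<bar>c\<bar>"
      using \<kappa> by auto
    ultimately have "\<bar>hom_integral A B E (\<lambda>p. \<kappa> (c * f p))\<bar> = \<bar>c\<bar> ^ card E * \<bar>hom_integral A B E (\<lambda>p. \<kappa> (f p))\<bar>"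
      by (simp add: abs_mult power_abs)
    \<comment> \<open>For \<open>c = 0\<close> both sides are 0, since \<open>card E\<close> is
      positive and \<open>0 powr r = 0\<close>.\<close>
    moreover have "(\<bar>c\<bar> ^ card E) powr r = \<bar>c\<bar>"
      using card by (cases "c = 0") (simp_all add: r_def powr_powr flip: powr_realpow)
    ultimately show ?thesis
      by (simp add: powr_mult)
  qed
  show ?thesis
    unfolding norm_on_def seminorm_on_def r_def[symmetric]
  proof (intro conjI ballI allI impI)
    fix f g :: "real \<times> real \<Rightarrow> real"
    assume fg: "f \<in> bounded_measurable" "g \<in> bounded_measurable"
    \<comment> \<open>The integrals depend on the functions only up to null sets, so Borel
      representatives reduce the claim to \<open>triangle\<close>.\<close>
    obtain f' where f': "f' \<in> bounded_borel" "AE p in lebesgue_on unit_square. f p = f' p"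
      using bounded_measurable_borel_representative[OF fg(1)] .
    obtain g' where g': "g' \<in> bounded_borel" "AE p in lebesgue_on unit_square. g p = g' p"
      using bounded_measurable_borel_representative[OF fg(2)] .
    have "AE p in lebesgue_on unit_square. f p + g p = f' p + g' p"
      using f'(2) g'(2) by eventually_elim simp
    from hom[OF bounded_borel_add[OF f'(1) g'(1)] this] hom[OF f'] hom[OF g']
    show "\<bar>hom_integral A B E (\<lambda>p. \<kappa> (f p + g p))\<bar> powr r \<le>
        \<bar>hom_integral A B E (\<lambda>p. \<kappa> (f p))\<bar> powr r + \<bar>hom_integral A B E (\<lambda>p. \<kappa> (g p))\<bar> powr r"
      using triangle[OF f'(1) g'(1)] by (simp add: t_def r_def)
  next
    fix f
    assume f: "f \<in> bounded_measurable" "\<bar>hom_integral A B E (\<lambda>p. \<kappa> (f p))\<bar> powr r = 0"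
    obtain f' where f': "f' \<in> bounded_borel" "AE p in lebesgue_on unit_square. f p = f' p"
      using bounded_measurable_borel_representative[OF f(1)] .
    have "AE p in lebesgue_on unit_square. f' p = 0"
      using f(2) hom[OF f'] by (intro definite f'(1)) (simp add: t_def)
    with f'(2) show "AE p in lebesgue_on unit_square. f p = 0"
      by eventually_elim simp
  qed (simp_all add: scale)
qed

theorem theorem1p3:
  fixes A B :: "'v set" and E :: "('v \<times> 'v) set"
  assumes "bipartite_graph A B E"
    and "bipartite_connected A B E"
  shows "(real_norming_on bounded_measurable_sym A B E \<longrightarrow>
            real_norming_on bounded_measurable A B E) \<and>
         (weakly_norming_on bounded_measurable_sym A B E \<longrightarrow>
            weakly_norming_on bounded_measurable A B E)"
proof -
  \<comment> \<open>\<open>weakly_norming_on\<close> takes the root without an absolute value;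
    nonnegativity identifies it with the case \<open>\<kappa> = abs\<close>.\<close>
  have "0 \<le> hom_integral A B E (\<lambda>p. \<bar>f p\<bar>)" for f
    unfolding hom_integral_def
    by (intro Bochner_Integration.integral_nonneg prod_nonneg) auto
  then show ?thesis
    using norm_on_asymmetric[OF assms, of id] norm_on_asymmetric[OF assms, of abs]
    by (simp add: real_norming_on_def weakly_norming_on_def)
qed

end
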